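(* Let $\{X(t):t\in\mathbb{R}\}$ be a centered stationary real Gaussian process with absolutely continuous sample paths and unit variance, with covariance $r$ and spectral measure $\rho$ satisfying $\int\lambda^2\,d\rho(\lambda)<\infty$. Suppose that either of the following holds: (a) the support of $\rho$ is compact and $\int_{\mathbb{R}}|r(t)|\,dt<\infty$; (b) for some $\kappa>0$ one has $\int_{\mathbb{R}}e^{|\lambda|\kappa}\,d\rho(\lambda)<\infty$, and for some $\kappa_o\in(0,\kappa/2)$ the function $r(t;\kappa_o):=\int_{\mathbb{R}}\cos(t\lambda)\cosh(2\kappa_o\lambda)\,d\rho(\lambda)$ satisfies $\int_{\mathbb{R}}|r(t;\kappa_o)|\,dt<\infty$. Then $\rho$ satisfies Assumption A (defined in the context), $\rho$ has a bounded, continuous density, and almost surely the sample path $t\mapsto X(t)$ is in $C^\infty(\mathbb{R})$.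
   Context: The covariance is $r(t-s)=\mathrm{Cov}[X(t),X(s)]$, $r(0)=1$, and the spectral measure $\rho$ is the (symmetric) probability measure on $\mathbb{R}$ with $r(t)=\int_{\mathbb{R}}e^{-i\lambda t}\,d\rho(\lambda)$. Assumption A: $\rho$ is non-atomic, $\int_{\mathbb{R}}e^{|\lambda|\kappa}\,d\rho(\lambda)<\infty$ for some $\kappa>0$, and for some $\kappa'\in(0,\kappa/2)$ and some finite real number $x_\star$, $$\omega_\star(k):=\sum_{j\ge k}|r(jx_\star)|+\sup_{|y|<\kappa'}\Big\{\sum_{j\ge k}|r_1'(jx_\star;2y)|+\sum_{j\ge k}|r_2''(jx_\star;y)|\Big\}\to0\quad\text{as }k\to\infty,$$ where $\varphi(\lambda):=\sinh(\lambda)/\lambda$ (with $\varphi(0)=1$), $r_\ell(x;y):=\int_{\mathbb{R}}e^{-i\lambda x}(\varphi(\lambda y))^\ell\,d\rho(\lambda)$ for $\ell=1,2$, and primes denote derivatives with respect to $x$. *)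

theory Defs
  imports "HOL-Probability.Probability"
begin

section \<open>Gaussian processes indexed by the real line\<close>

text \<open>The law \<open>N(m, s\<^sup>2)\<close>; for \<open>s = 0\<close> it is the point mass at \<open>m\<close>.\<close>
definition normal_law :: "real \<Rightarrow> real \<Rightarrow> real measure" where
  "normal_law m s =
     (if s = 0 then return borel m else density lborel (\<lambda>x. ennreal (normal_density m s x)))"

text \<open>All finite linear combinations are (possibly degenerate) normal variables.\<close>
definition gaussian_process :: "'a measure \<Rightarrow> (real \<Rightarrow> 'a \<Rightarrow> real) \<Rightarrow> bool" where
  "gaussian_process M X \<longleftrightarrow>
     prob_space M \<and>
     (\<forall>t. X t \<in> borel_measurable M) \<and>
     (\<forall>J c. finite J \<longrightarrow>
        (\<exists>m s. 0 \<le> s \<and> distr M borel (\<lambda>\<omega>. \<Sum>t\<in>J. c t * X t \<omega>) = normal_law m s))"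

definition stationary_process :: "'a measure \<Rightarrow> (real \<Rightarrow> 'a \<Rightarrow> real) \<Rightarrow> bool" where
  "stationary_process M X \<longleftrightarrow>
     (\<forall>J h. finite J \<longrightarrow>
        distr M (\<Pi>\<^sub>M t\<in>J. borel) (\<lambda>\<omega>. \<lambda>t\<in>J. X (t + h) \<omega>) =
        distr M (\<Pi>\<^sub>M t\<in>J. borel) (\<lambda>\<omega>. \<lambda>t\<in>J. X t \<omega>))"

definition covariance :: "'a measure \<Rightarrow> ('a \<Rightarrow> real) \<Rightarrow> ('a \<Rightarrow> real) \<Rightarrow> real" where
  "covariance M Y Z =
     (\<integral>\<omega>. (Y \<omega> - (\<integral>\<omega>. Y \<omega> \<partial>M)) * (Z \<omega> - (\<integral>\<omega>. Z \<omega> \<partial>M)) \<partial>M)"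

section \<open>Regularity of sample paths\<close>

definition abs_continuous_on_interval :: "real \<Rightarrow> real \<Rightarrow> (real \<Rightarrow> real) \<Rightarrow> bool" where
  "abs_continuous_on_interval a b f \<longleftrightarrow>
     (\<forall>\<epsilon>>0. \<exists>\<delta>>0. \<forall>(n::nat) u v.
        (\<forall>i<n. a \<le> u i \<and> u i \<le> v i \<and> v i \<le> b) \<and>
        disjoint_family_on (\<lambda>i. {u i<..<v i}) {..<n} \<and>
        (\<Sum>i<n. v i - u i) < \<delta> \<longrightarrow>
        (\<Sum>i<n. \<bar>f (v i) - f (u i)\<bar>) < \<epsilon>)"

text \<open>On the whole line, absolute continuity is understood on every compact interval.\<close>
definition abs_continuous_path :: "(real \<Rightarrow> real) \<Rightarrow> bool" where
  "abs_continuous_path f \<longleftrightarrow> (\<forall>a b. abs_continuous_on_interval a b f)"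

text \<open>Derivatives of all orders exist everywhere; they are then automatically continuous.\<close>
definition C_infinity :: "(real \<Rightarrow> real) \<Rightarrow> bool" where
  "C_infinity f \<longleftrightarrow> (\<forall>n. ((deriv ^^ n) f) differentiable_on UNIV)"

section \<open>Spectral measures\<close>

definition fourier_transform :: "real measure \<Rightarrow> real \<Rightarrow> complex" where
  "fourier_transform \<rho> t = (\<integral>u. exp (- \<i> * of_real u * of_real t) \<partial>\<rho>)"

definition spectral_measure :: "(real \<Rightarrow> real) \<Rightarrow> real measure \<Rightarrow> bool" where
  "spectral_measure r \<rho> \<longleftrightarrow>
     real_distribution \<rho> \<and>
     distr \<rho> borel uminus = \<rho> \<and>
     (\<forall>t. complex_of_real (r t) = fourier_transform \<rho> t)"

definition measure_support :: "real measure \<Rightarrow> real set" where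
  "measure_support \<rho> = {x. \<forall>U. open U \<and> x \<in> U \<longrightarrow> emeasure \<rho> U > 0}"

definition has_bounded_continuous_density :: "real measure \<Rightarrow> bool" where
  "has_bounded_continuous_density \<rho> \<longleftrightarrow>
     (\<exists>p. (\<forall>x. 0 \<le> p x) \<and> bounded (range p) \<and> continuous_on UNIV p \<and>
          \<rho> = density lborel (\<lambda>x. ennreal (p x)))"

section \<open>Assumption A\<close>

definition sinhc :: "real \<Rightarrow> real" where
  "sinhc u = (if u = 0 then 1 else sinh u / u)"

definition r_smooth :: "real measure \<Rightarrow> nat \<Rightarrow> real \<Rightarrow> real \<Rightarrow> complex" where
  "r_smooth \<rho> l x y =
     (\<integral>u. exp (- \<i> * of_real u * of_real x) * of_real (sinhc (u * y) ^ l) \<partial>\<rho>)"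

text \<open>
  Derivatives in the real variable \<open>x\<close> of complex-valued functions.  In \<open>assumption_A\<close> they are evaluated
  only where \<open>r_smooth\<close> is smooth in \<open>x\<close>: both \<open>sinhc (2 * y * u)\<close> and
  \<open>sinhc (y * u)^2\<close> are at most \<open>exp (2 * \<bar>y\<bar> * \<bar>u\<bar>)\<close>, and \<open>2 * \<bar>y\<bar> < \<kappa>\<close>.
\<close>
definition r1_deriv :: "real measure \<Rightarrow> real \<Rightarrow> real \<Rightarrow> complex" where
  "r1_deriv \<rho> x y = vector_derivative (\<lambda>z. r_smooth \<rho> 1 z y) (at x)"

definition r2_deriv2 :: "real measure \<Rightarrow> real \<Rightarrow> real \<Rightarrow> complex" where
  "r2_deriv2 \<rho> x y =
     vector_derivative (\<lambda>w. vector_derivative (\<lambda>z. r_smooth \<rho> 2 z y) (at w)) (at x)"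

text \<open>The sums over \<open>j \<ge> k\<close> and the supremum may be infinite, hence the values in \<open>[0, \<infinity>]\<close>.\<close>
definition omega_star :: "real measure \<Rightarrow> real \<Rightarrow> real \<Rightarrow> nat \<Rightarrow> ennreal" where
  "omega_star \<rho> \<kappa>' x k =
     (\<Sum>\<^sub>\<infinity>j\<in>{k..}. ennreal (cmod (fourier_transform \<rho> (real j * x)))) +
     (SUP y\<in>{y. \<bar>y\<bar> < \<kappa>'}.
        (\<Sum>\<^sub>\<infinity>j\<in>{k..}. ennreal (cmod (r1_deriv \<rho> (real j * x) (2 * y)))) +
        (\<Sum>\<^sub>\<infinity>j\<in>{k..}. ennreal (cmod (r2_deriv2 \<rho> (real j * x) y))))"

definition assumption_A :: "real measure \<Rightarrow> bool" where
  "assumption_A \<rho> \<longleftrightarrow>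
     (\<forall>x. emeasure \<rho> {x} = 0) \<and>
     (\<exists>\<kappa>>0. integrable \<rho> (\<lambda>u. exp (\<bar>u\<bar> * \<kappa>)) \<and>
        (\<exists>\<kappa>' x. 0 < \<kappa>' \<and> \<kappa>' < \<kappa> / 2 \<and> omega_star \<rho> \<kappa>' x \<longlonglongrightarrow> 0))"

definition r_cosh :: "real measure \<Rightarrow> real \<Rightarrow> real \<Rightarrow> real" where
  "r_cosh \<rho> \<kappa> t = (\<integral>u. cos (t * u) * cosh (2 * \<kappa> * u) \<partial>\<rho>)"

end

theory Submission
  imports Defs
begin

text \<open>
  The statement has an analytic part, about \<open>\<rho>\<close>, and a probabilistic part, about the sample paths.

  Analytic part. Both hypotheses say that \<open>\<rho>\<close> is a weight times a probability measure \<open>\<mu>\<close> with integrable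
  characteristic function, where the weight \<open>E\<close> is \<open>C\<^sup>2\<close> and decays exponentially together with two
  derivatives. In case (b), \<open>\<mu>\<close> is the normalised \<open>cosh (2 * \<kappa>\<^sub>o * u)\<close> times \<open>\<rho>\<close> and \<open>E\<close> is a
  multiple of \<open>1 / cosh (2 * \<kappa>\<^sub>o * u)\<close>; in case (a), \<open>\<mu> = \<rho>\<close> and \<open>E\<close> is a cutoff that equals \<open>1\<close> on the
  support. Fourier inversion (\<open>eq_density_fourier_density\<close>) gives \<open>\<mu>\<close>, hence \<open>\<rho>\<close>, a bounded continuous
  density. The covariance and the derivatives of the smoothed covariances in Assumption A are integrals of
  \<open>iexp (- (x * u)) * v u\<close> over \<open>\<rho>\<close>, with multipliers \<open>v\<close> that grow exponentially at a rate controlled by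
  \<open>\<kappa>'\<close>. For small \<open>\<kappa>'\<close> the product \<open>v * E\<close> decays with two derivatives, so its Fourier transform is
  \<open>O(1 / (1 + x\<^sup>2))\<close>, uniformly in \<open>y\<close>; by Parseval's formula each integral is the convolution of
  \<open>char \<mu>\<close>, which is integrable, with this transform. Such a convolution is summable along the integers, because
  the shifted sums of \<open>1 / (1 + x\<^sup>2)\<close> are uniformly bounded. This is
  \<open>assumption_A_and_density_criterion\<close>, with \<open>1\<close> as the spacing \<open>x\<^sub>\<star>\<close>.

  Probabilistic part. A linear combination of values of \<open>X\<close> has as second moment the integral over \<open>\<rho>\<close> of the
  squared modulus of the same combination of exponentials. An exponential moment of \<open>\<rho>\<close> therefore makes the
  Taylor series of \<open>X\<close> converge as the Taylor series of the exponential does: the dyadic difference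
  quotients of every order converge almost surely, and for \<open>\<bar>s\<bar> \<le> \<kappa> / 4\<close> the series built from their limits at
  \<open>t\<close> sums to \<open>X (t + s)\<close> almost surely (\<open>AE_taylor_series\<close>). Almost surely this holds for all rational
  \<open>t\<close> and \<open>s\<close>, and continuity of the path extends it to all real \<open>s\<close>, so that the path is real analytic.
\<close>

section \<open>Fourier inversion for probability measures\<close>

definition fourier_density :: "real measure \<Rightarrow> real \<Rightarrow> complex" where
  "fourier_density \<mu> x = (CLBINT t. char \<mu> t * iexp (- (t * x))) / (2 * pi)"

lemma norm_fourier_density_le:
  assumes "integrable lborel (char \<mu>)"
  shows "cmod (fourier_density \<mu> x) \<le> (LBINT t. cmod (char \<mu> t)) / (2 * pi)"
proof -
  have "cmod (CLBINT t. char \<mu> t * iexp (- (t * x))) \<le> (LBINT t. cmod (char \<mu> t * iexp (- (t * x))))"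
    by (rule integral_norm_bound)
  then show ?thesis
    by (simp add: fourier_density_def norm_divide norm_mult divide_right_mono)
qed

lemma Ioc_iexp_integral:
  assumes "a \<le> b" "t \<noteq> 0"
  shows "(CLBINT x. indicator {a<..b} x *\<^sub>R iexp (- (t * x))) = (iexp (- (t * a)) - iexp (- (t * b))) / (\<i> * t)"
proof -
  have "(CLBINT x=a..b. iexp (- (t * x))) = - iexp (- (t * b)) / (\<i> * t) - - iexp (- (t * a)) / (\<i> * t)"
  proof (rule interval_integral_FTC_finite)
    show "((\<lambda>x. - iexp (- (t * x)) / (\<i> * t)) has_vector_derivative iexp (- (t * x)))
           (at x within {min a b..max a b})" for x
      using \<open>t \<noteq> 0\<close> by (auto intro!: derivative_eq_intros has_vector_derivative_real_field simp: field_simps)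
  qed (auto intro!: continuous_intros)
  moreover have "(CLBINT x=a..b. iexp (- (t * x))) = (CLBINT x:{a<..b}. iexp (- (t * x)))"
    using \<open>a \<le> b\<close> by (rule interval_integral_Ioc)
  ultimately show ?thesis
    by (simp add: set_lebesgue_integral_def diff_divide_distrib)
qed

context real_distribution
begin

context
  assumes int_char: "integrable lborel (char M)"
begin

lemma isCont_fourier_density: "isCont (fourier_density M) x"
  unfolding continuous_at_sequentially
proof safe
  fix X assume X: "X \<longlonglongrightarrow> x"
  have "(\<lambda>n. CLBINT t. char M t * iexp (- (t * X n))) \<longlonglongrightarrow> (CLBINT t. char M t * iexp (- (t * x)))"
    by (rule integral_dominated_convergence[where w="\<lambda>t. cmod (char M t)"])
       (use int_char in \<open>auto intro!: tendsto_intros X simp: norm_mult\<close>)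
  then show "(fourier_density M \<circ> X) \<longlonglongrightarrow> fourier_density M x"
    unfolding comp_def fourier_density_def by (intro tendsto_intros) auto
qed

lemma continuous_on_fourier_density [continuous_intros]: "continuous_on A (fourier_density M)"
  using isCont_fourier_density continuous_at_imp_continuous_on by blast

lemma measurable_fourier_density [measurable]: "fourier_density M \<in> borel_measurable borel"
  by (intro borel_measurable_continuous_onI continuous_on_fourier_density)

text \<open>
  Levy's inversion formula expresses the mass of \<open>{a<..b}\<close> as a limit of truncated integrals of
  \<open>char M\<close> against the Fourier transform of the indicator of \<open>{a<..b}\<close>. That transform is bounded by
  \<open>b - a\<close>, so integrability of \<open>char M\<close> lets the truncation go and the order of integration
  be exchanged.
\<close>

lemma measure_Ioc_non_atom_eq:
  assumes "a \<le> b" "prob {a} = 0" "prob {b} = 0"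
  shows "complex_of_real (prob {a<..b}) = (CLBINT x. indicator {a<..b} x *\<^sub>R fourier_density M x)"
proof -
  let ?F = "\<lambda>t::real. (iexp (- (t * a)) - iexp (- (t * b))) / (\<i> * t)"
  let ?I = "\<lambda>t. CLBINT x. indicator {a<..b} x *\<^sub>R iexp (- (t * x))"
  \<comment> \<open>\<open>?I t\<close> is \<open>?F t\<close> except at \<open>t = 0\<close>, where the latter is a division by zero.\<close>
  have F_le: "cmod (?I t) \<le> b - a" for t
  proof -
    have "cmod (?I t) \<le> (LBINT x. cmod (indicator {a<..b} x *\<^sub>R iexp (- (t * x))))"
      by (rule integral_norm_bound)
    also have "\<dots> = (LBINT x. indicator {a<..b} x)"
      by (intro Bochner_Integration.integral_cong) auto
    finally show ?thesis using \<open>a \<le> b\<close> by simp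
  qed
  have [measurable]: "?I \<in> borel_measurable borel"
    by measurable
  have "(\<lambda>T::nat. CLBINT t. indicator {-T<..<T} t *\<^sub>R (?I t * char M t)) \<longlonglongrightarrow> (CLBINT t. ?I t * char M t)"
  proof (rule integral_dominated_convergence[where w="\<lambda>t. (b - a) * cmod (char M t)"])
    show "AE t in lborel. (\<lambda>T::nat. indicator {-T<..<T} t *\<^sub>R (?I t * char M t)) \<longlonglongrightarrow> ?I t * char M t"
    proof (intro AE_I2 tendsto_eventually)
      fix t :: real
      obtain N :: nat where "\<bar>t\<bar> < N" using reals_Archimedean2 by blast
      then have "\<forall>T\<ge>N. indicator {- real T<..<real T} t = (1::real)" by (auto simp: indicator_def)
      then show "\<forall>\<^sub>F T::nat in sequentially. indicator {-T<..<T} t *\<^sub>R (?I t * char M t) = ?I t * char M t"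
        unfolding eventually_sequentially by (intro exI[of _ N]) auto
    qed
  qed (use int_char F_le in \<open>auto simp: norm_mult indicator_def mult_right_mono \<open>a \<le> b\<close>\<close>)
  moreover have "(CLBINT t. indicator {-T<..<T} t *\<^sub>R (?I t * char M t)) = (CLBINT t=-T..T. ?F t * char M t)"
    for T :: nat
  proof -
    have "(CLBINT t=-T..T. ?F t * char M t) = (CLBINT t. indicator {-T<..<T} t *\<^sub>R (?F t * char M t))"
      by (simp add: interval_lebesgue_integral_def set_lebesgue_integral_def)
    also have "\<dots> = (CLBINT t. indicator {-T<..<T} t *\<^sub>R (?I t * char M t))"
      using Ioc_iexp_integral[OF \<open>a \<le> b\<close>]
      by (intro integral_cong_AE) (auto intro!: AE_I[of _ _ "{0}"])
    finally show ?thesis by simp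
  qed
  ultimately have "(\<lambda>T::nat. 1 / (2 * pi) * (CLBINT t=-T..T. ?F t * char M t)) \<longlonglongrightarrow> 1 / (2 * pi) * (CLBINT t. ?I t * char M t)"
    by (intro tendsto_intros) simp
  with Levy_Inversion[OF assms] have "complex_of_real (prob {a<..b}) = 1 / (2 * pi) * (CLBINT t. ?I t * char M t)"
    using LIMSEQ_unique by blast
  also have "(CLBINT t. ?I t * char M t) = (CLBINT t. CLBINT x. indicator {a<..b} x *\<^sub>R (char M t * iexp (- (t * x))))"
    by (intro Bochner_Integration.integral_cong refl)
       (simp add: mult.commute[of _ "char M _"] flip: integral_mult_right_zero)
  also have "\<dots> = (CLBINT x. CLBINT t. indicator {a<..b} x *\<^sub>R (char M t * iexp (- (t * x))))"
  proof -
    have "integrable (lborel \<Otimes>\<^sub>M lborel) (\<lambda>(t, x). indicator {a<..b} x *\<^sub>R (char M t * iexp (- (t * x))))"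
    proof (rule lborel_pair.Fubini_integrable)
      have "(LBINT x. indicat_real {a<..b} x * cmod (char M t)) = (b - a) * cmod (char M t)" for t
        using \<open>a \<le> b\<close> by simp
      then show "integrable lborel (\<lambda>t. LBINT x. norm (case (t, x) of (t, x) \<Rightarrow>
            indicator {a<..b} x *\<^sub>R (char M t * iexp (- (t * x)))))"
        using int_char by (simp add: norm_mult)
      have "integrable lborel (\<lambda>x. indicator {a<..b} x *\<^sub>R (char M t * iexp (- (t * x))))" for t
        using cmod_char_le_1 \<open>a \<le> b\<close>
        by (intro integrableI_bounded_set_indicator[where B=1]) (auto simp: norm_mult)
      then show "AE t in lborel. integrable lborel (\<lambda>x. case (t, x) of (t, x) \<Rightarrow>
            indicator {a<..b} x *\<^sub>R (char M t * iexp (- (t * x))))"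
        by simp
    qed measurable
    then show ?thesis
      using lborel_pair.Fubini_integral[of "\<lambda>t x. indicator {a<..b} x *\<^sub>R (char M t * iexp (- (t * x)))"]
      by simp
  qed
  also have "1 / (2 * pi) * \<dots> = (CLBINT x. indicator {a<..b} x *\<^sub>R fourier_density M x)"
    by (simp add: fourier_density_def scaleR_conv_of_real)
  finally show ?thesis .
qed

text \<open>
  An interval of length \<open>d\<close> with non-atomic end points has mass at most a constant times \<open>d\<close>, because the
  density is bounded; shrinking such intervals around a point shows that the point has no mass. This removes
  the restriction on the end points from the inversion formula.
\<close>

lemma non_atomic_of_integrable_char: "prob {x} = 0"
proof (rule ccontr)
  define C where "C = (LBINT t. cmod (char M t)) / (2 * pi)"
  have "C \<ge> 0" by (simp add: C_def)
  assume "prob {x} \<noteq> 0"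
  then have pos: "prob {x} > 0"
    using measure_nonneg[of M "{x}"] by linarith
  define d where "d = prob {x} / (2 * C + 1)"
  have "d > 0" using pos \<open>C \<ge> 0\<close> by (simp add: d_def)
  \<comment> \<open>There are only countably many atoms, so \<open>x\<close> has close neighbours that are none.\<close>
  have "\<exists>y\<in>{u<..<v}. prob {y} = 0" if "u < v" for u v :: real
  proof (rule ccontr)
    assume "\<not> (\<exists>y\<in>{u<..<v}. prob {y} = 0)"
    then have "{u<..<v} \<subseteq> {y. prob {y} > 0}"
      using measure_nonneg[of M] by (auto simp: order_less_le)
    with countable_atoms have "countable {u<..<v}"
      using countable_subset by blast
    with uncountable_open_interval[of u v] that show False by simp
  qed
  from this[of "x - d" x] this[of x "x + d"] obtain a b where "a \<in> {x - d<..<x}" "prob {a} = 0" "b \<in> {x<..<x + d}" "prob {b} = 0"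
    using \<open>d > 0\<close> by auto
  then have a: "x - d < a" "a < x" "prob {a} = 0" and b: "x < b" "b < x + d" "prob {b} = 0"
    by auto
  have "prob {x} \<le> prob {a<..b}"
    using a b by (intro finite_measure_mono) auto
  also have "\<dots> = cmod (CLBINT y. indicator {a<..b} y *\<^sub>R fourier_density M y)"
    using a b by (subst measure_Ioc_non_atom_eq[symmetric]) auto
  also have "\<dots> \<le> (LBINT y. cmod (indicator {a<..b} y *\<^sub>R fourier_density M y))"
    by (rule integral_norm_bound)
  also have "\<dots> \<le> (LBINT y. C * indicator {a<..b} y)"
  proof (rule integral_mono)
    show "integrable lborel (\<lambda>y. cmod (indicator {a<..b} y *\<^sub>R fourier_density M y))"
      using norm_fourier_density_le[OF int_char] a b
      by (intro integrable_norm integrableI_bounded_set_indicator[where B=C]) (auto simp: C_def)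
    show "integrable lborel (\<lambda>y. C * indicator {a<..b} y)"
      using a b by (intro integrable_mult_right integrable_real_indicator) auto
  qed (use norm_fourier_density_le[OF int_char] in \<open>auto simp: C_def indicator_def\<close>)
  also have "\<dots> = C * (b - a)"
    using a b by simp
  also have "\<dots> \<le> C * (2 * d)"
    using a b \<open>C \<ge> 0\<close> by (intro mult_left_mono) auto
  also have "\<dots> < (2 * C + 1) * d"
    using \<open>d > 0\<close> by (simp add: algebra_simps)
  also have "\<dots> = prob {x}"
    using \<open>C \<ge> 0\<close> by (simp add: d_def)
  finally show False by simp
qed

text \<open>
  By the inversion formula the distribution function is locally a constant plus an integral of the
  continuous function \<open>Re (fourier_density M)\<close>; being monotone, it forces that function to be nonnegative,
  and the fundamental theorem of calculus on half-lines then identifies \<open>M\<close>.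
\<close>

lemma cdf_has_derivative_fourier_density: "DERIV (cdf M) x :> Re (fourier_density M x)"
proof -
  let ?q = "\<lambda>x. Re (fourier_density M x)"
  have cont: "continuous_on A ?q" for A
    by (intro continuous_intros)
  have eq: "cdf M y = cdf M (x - 1) + integral {x - 1..y} ?q" if "y \<in> {x - 1<..<x + 1}" for y
  proof -
    from that have "x - 1 < y" by simp
    have "cdf M y - cdf M (x - 1) = prob {x - 1<..y}"
      using cdf_diff_eq[OF \<open>x - 1 < y\<close>] .
    also have "\<dots> = Re (CLBINT x:{x - 1<..y}. fourier_density M x)"
      using \<open>x - 1 < y\<close> non_atomic_of_integrable_char
      by (simp flip: measure_Ioc_non_atom_eq add: set_lebesgue_integral_def)
    also have "(CLBINT x:{x - 1<..y}. fourier_density M x) = (CLBINT x:{x - 1..y}. fourier_density M x)"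
      by (rule set_integral_cong_set) (auto intro!: AE_I[of _ _ "{x - 1}"] simp: set_borel_measurable_def)
    also have "\<dots> = integral {x - 1..y} (fourier_density M)"
      by (intro set_borel_integral_eq_integral borel_integrable_atLeastAtMost') (intro continuous_intros)
    also have "Re \<dots> = integral {x - 1..y} ?q"
      using integral_linear[OF integrable_continuous_interval[OF continuous_on_fourier_density] bounded_linear_Re,
          of "x - 1" y]
      by (simp add: comp_def)
    finally show ?thesis by simp
  qed
  have "((\<lambda>y. integral {x - 1..y} ?q) has_real_derivative ?q x) (at x within {x - 1..x + 1})"
    by (rule integral_has_real_derivative) (use cont in auto)
  then have "((\<lambda>y. integral {x - 1..y} ?q) has_real_derivative ?q x) (at x)"
    by (simp add: at_within_Icc_at)
  then have "((\<lambda>y. cdf M (x - 1) + integral {x - 1..y} ?q) has_real_derivative ?q x) (at x)"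
    by (auto intro!: derivative_eq_intros)
  then show ?thesis
    by (rule has_field_derivative_transform_within_open[where S="{x - 1<..<x + 1}"]) (auto simp: eq)
qed

lemma Re_fourier_density_nonneg: "0 \<le> Re (fourier_density M x)"
proof (rule ccontr)
  assume "\<not> 0 \<le> Re (fourier_density M x)"
  then obtain d where "d > 0" "\<And>h. 0 < h \<Longrightarrow> h < d \<Longrightarrow> cdf M (x + h) < cdf M x"
    using DERIV_neg_dec_right[OF cdf_has_derivative_fourier_density] by (metis not_le)
  from this(2)[of "d / 2"] \<open>d > 0\<close> cdf_nondecreasing[of x "x + d / 2"] show False by simp
qed

lemma eq_density_fourier_density: "M = density lborel (\<lambda>x. ennreal (Re (fourier_density M x)))"
proof (rule measure_eqI_lessThan)
  fix x
  have "emeasure (density lborel (\<lambda>x. ennreal (Re (fourier_density M x)))) {x<..}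
    = (\<integral>\<^sup>+y. ennreal (Re (fourier_density M y)) * indicator {x..} y \<partial>lborel)"
    by (subst emeasure_density)
       (auto intro!: nn_integral_cong_AE eventually_mono[OF AE_lborel_singleton[of x]] simp: indicator_def)
  also have "\<dots> = 1 - cdf M x"
    by (rule nn_integral_FTC_atLeast)
       (auto simp: Re_fourier_density_nonneg cdf_lim_at_top_prob cdf_has_derivative_fourier_density)
  also have "\<dots> = emeasure M {x<..}"
    using prob_compl[of "{..x}"] by (simp add: cdf_def2 emeasure_eq_measure Compl_eq_Diff_UNIV[symmetric])
  finally show "emeasure M {x<..} = emeasure (density lborel (\<lambda>x. ennreal (Re (fourier_density M x)))) {x<..}"
    by simp
qed (auto simp: emeasure_eq_measure)

text \<open>
  \<open>char M (- t)\<close> is the conjugate of \<open>char M t\<close>, so conjugation only reflects the integration variable.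
\<close>

lemma Im_fourier_density_zero: "Im (fourier_density M x) = 0"
proof -
  have cnj_char: "cnj (char M t) = char M (- t)" for t
    using Bochner_Integration.integral_cnj[of M "\<lambda>x. iexp (t * x)"] by (simp add: char_def exp_cnj)
  have "cnj (CLBINT t. char M t * iexp (- (t * x))) = (CLBINT t. char M (- t) * iexp (t * x))"
    using Bochner_Integration.integral_cnj[of lborel "\<lambda>t. char M t * iexp (- (t * x))"] by (simp add: exp_cnj cnj_char)
  also have "\<dots> = (CLBINT t. char M t * iexp (- (t * x)))"
    by (subst lborel_integral_real_affine[where c="-1" and t=0]) simp_all
  finally have "cnj (fourier_density M x) = fourier_density M x"
    by (simp add: fourier_density_def)
  then show ?thesis
    by (simp add: complex_eq_iff)
qed

end
end

section \<open>Decay of Fourier transforms and Parseval's formula\<close>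

lemma lborel_integrable_inverse_1_plus_square: "integrable lborel (\<lambda>u::real. 1 / (1 + u\<^sup>2))"
  using integrable_inverse_1_plus_square by (simp add: set_integrable_def inverse_eq_divide)

lemma lborel_integral_inverse_1_plus_square: "(LBINT u. 1 / (1 + u\<^sup>2)) = pi"
  using LBINT_inverse_1_plus_square by (simp add: interval_lebesgue_integral_def set_lebesgue_integral_def inverse_eq_divide)

text \<open>
  The derivatives are arguments, not \<open>deriv w\<close>, so that closure under products comes with explicit formulas.
  One bound \<open>g\<close> serves the function and both derivatives.
\<close>

definition C2_dominated :: "(real \<Rightarrow> real) \<Rightarrow> (real \<Rightarrow> real) \<Rightarrow> (real \<Rightarrow> real) \<Rightarrow> (real \<Rightarrow> real) \<Rightarrow> bool" where
  "C2_dominated g w w' w'' \<longleftrightarrow>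
     (\<forall>u. (w has_real_derivative w' u) (at u)) \<and> (\<forall>u. (w' has_real_derivative w'' u) (at u)) \<and>
     continuous_on UNIV w'' \<and> (\<forall>u. \<bar>w u\<bar> \<le> g u \<and> \<bar>w' u\<bar> \<le> g u \<and> \<bar>w'' u\<bar> \<le> g u)"

lemma integrable_of_inverse_square_bound:
  fixes f :: "real \<Rightarrow> real"
  assumes [measurable]: "f \<in> borel_measurable borel" and "\<And>u. \<bar>f u\<bar> \<le> B / (1 + u\<^sup>2)"
  shows "integrable lborel f" "(LBINT u. \<bar>f u\<bar>) \<le> B * pi"
proof -
  have int: "integrable lborel (\<lambda>u. B * (1 / (1 + u\<^sup>2)))"
    by (intro integrable_mult_right lborel_integrable_inverse_1_plus_square)
  show f: "integrable lborel f"
    by (rule Bochner_Integration.integrable_bound[OF int])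
       (auto intro!: order_trans[OF assms(2)] divide_right_mono)
  have "(LBINT u. \<bar>f u\<bar>) \<le> (LBINT u. B * (1 / (1 + u\<^sup>2)))"
    using f int assms by (intro integral_mono) auto
  then show "(LBINT u. \<bar>f u\<bar>) \<le> B * pi"
    by (simp only: integral_mult_right_zero lborel_integral_inverse_1_plus_square)
qed

text \<open>
  Two integrations by parts in one step: the function \<open>F u = iexp (- (x * u)) * (w' u + \<i> * x * w u)\<close>
  vanishes at infinity and has derivative \<open>iexp (- (x * u)) * (w'' u + x\<^sup>2 * w u)\<close>. Hence \<open>x\<^sup>2\<close> times the
  transform of \<open>w\<close> is minus the transform of \<open>w''\<close>, and both transforms are bounded by \<open>L\<^sup>1\<close> norms, that is,
  by \<open>B * pi\<close>.
\<close>

lemma norm_fourier_integral_le: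
  assumes "C2_dominated (\<lambda>u. B / (1 + u\<^sup>2)) w w' w''"
  shows "cmod (CLBINT u. w u * iexp (- (x * u))) \<le> 2 * pi * B / (1 + x\<^sup>2)"
proof -
  have w: "(w has_real_derivative w' u) (at u)" and w': "(w' has_real_derivative w'' u) (at u)"
    and w''_cont: "continuous_on UNIV w''"
    and le: "\<bar>w u\<bar> \<le> B / (1 + u\<^sup>2)" "\<bar>w' u\<bar> \<le> B / (1 + u\<^sup>2)" "\<bar>w'' u\<bar> \<le> B / (1 + u\<^sup>2)" for u
    using assms by (auto simp: C2_dominated_def)
  have w_cont: "continuous_on UNIV w"
    using w by (meson DERIV_continuous continuous_at_imp_continuous_on)
  have [measurable]: "w \<in> borel_measurable borel" "w'' \<in> borel_measurable borel"
    using w_cont w''_cont by (auto intro: borel_measurable_continuous_onI)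
  note int = integrable_of_inverse_square_bound[OF _ le(1)] integrable_of_inverse_square_bound[OF _ le(3)]
  have int_w: "integrable lborel (\<lambda>u. w u * iexp (- (x * u)))"
    by (rule Bochner_Integration.integrable_bound[OF int(1)]) (auto simp: norm_mult)
  have int_w'': "integrable lborel (\<lambda>u. w'' u * iexp (- (x * u)))"
    by (rule Bochner_Integration.integrable_bound[OF int(3)]) (auto simp: norm_mult)
  define F where "F u = iexp (- (x * u)) * (w' u + \<i> * x * w u)" for u
  define f where "f u = w'' u * iexp (- (x * u)) + x\<^sup>2 * (w u * iexp (- (x * u)))" for u
  have F_deriv: "(F has_vector_derivative f u) (at u)" for u
  proof -
    have "((\<lambda>u. complex_of_real (w u)) has_vector_derivative w' u) (at u)"
         "((\<lambda>u. complex_of_real (w' u)) has_vector_derivative w'' u) (at u)"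
      using w w' by (auto intro!: derivative_eq_intros simp: has_real_derivative_iff_has_vector_derivative)
    then show ?thesis
      unfolding F_def f_def
      by (auto intro!: derivative_eq_intros has_vector_derivative_real_field w w' simp: algebra_simps power2_eq_square)
  qed
  have F_le: "cmod (F u) \<le> (1 + \<bar>x\<bar>) * B * (1 / (1 + u\<^sup>2))" for u
  proof -
    have "cmod (F u) \<le> \<bar>w' u\<bar> + \<bar>x\<bar> * \<bar>w u\<bar>"
      unfolding F_def by (simp add: norm_mult) (rule norm_triangle_le, simp add: norm_mult)
    also have "\<dots> \<le> B / (1 + u\<^sup>2) + \<bar>x\<bar> * (B / (1 + u\<^sup>2))"
      by (intro add_mono mult_left_mono le) auto
    finally show ?thesis by (simp add: distrib_right add_divide_distrib)
  qed
  have top: "(F \<longlongrightarrow> 0) at_top"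
    by (rule Lim_null_comparison[OF always_eventually[OF allI[OF F_le]]]) real_asymp
  have bot: "(F \<longlongrightarrow> 0) at_bot"
    by (rule Lim_null_comparison[OF always_eventually[OF allI[OF F_le]]]) real_asymp
  have int_f: "integrable lborel f"
    unfolding f_def using int_w int_w'' by simp
  have "(CLBINT u=-\<infinity>..\<infinity>. f u) = 0 - 0"
  proof (rule interval_integral_FTC_integrable[of _ _ F])
    show "isCont f u" for u
      using continuous_on_eq_continuous_at[THEN iffD1, OF open_UNIV w_cont]
        continuous_on_eq_continuous_at[THEN iffD1, OF open_UNIV w''_cont]
      unfolding f_def by (intro continuous_intros) auto
  qed (use F_deriv int_f top bot in \<open>auto simp: ereal_tendsto_simps set_integrable_def\<close>)
  then have "(CLBINT u. f u) = 0"
    by (simp add: interval_lebesgue_integral_def set_lebesgue_integral_def)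
  then have eq: "(CLBINT u. w'' u * iexp (- (x * u))) + x\<^sup>2 * (CLBINT u. w u * iexp (- (x * u))) = 0"
    unfolding f_def using int_w int_w'' by simp
  have 1: "cmod (CLBINT u. w u * iexp (- (x * u))) \<le> B * pi"
    using integral_norm_bound[of lborel "\<lambda>u. w u * iexp (- (x * u))"] int(2) by (simp add: norm_mult)
  have "x\<^sup>2 * cmod (CLBINT u. w u * iexp (- (x * u))) = cmod (CLBINT u. w'' u * iexp (- (x * u)))"
  proof -
    have "(CLBINT u. w'' u * iexp (- (x * u))) = - (x\<^sup>2 * (CLBINT u. w u * iexp (- (x * u))))"
      using eq by (simp add: eq_neg_iff_add_eq_0)
    then show ?thesis by (simp add: norm_mult norm_power)
  qed
  also have "\<dots> \<le> B * pi"
    using integral_norm_bound[of lborel "\<lambda>u. w'' u * iexp (- (x * u))"] int(4) by (simp add: norm_mult)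
  finally have "(1 + x\<^sup>2) * cmod (CLBINT u. w u * iexp (- (x * u))) \<le> 2 * pi * B"
    using 1 by (simp add: algebra_simps)
  then show ?thesis
    by (simp add: pos_le_divide_eq add_pos_nonneg mult.commute)
qed

text \<open>
  Parseval's formula, obtained from Fubini after inserting the integral that defines the density.
\<close>

lemma (in real_distribution) integral_mult_fourier_density:
  fixes w :: "real \<Rightarrow> complex"
  assumes int_char: "integrable lborel (char M)" and w: "integrable lborel w"
  shows "(CLBINT u. w u * fourier_density M u) = (CLBINT t. char M t * (CLBINT u. w u * iexp (- (t * u)))) / (2 * pi)"
proof -
  have [measurable]: "w \<in> borel_measurable borel"
    using w by auto
  have "integrable (lborel \<Otimes>\<^sub>M lborel) (\<lambda>(t, u). char M t * (w u * iexp (- (t * u))))"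
  proof (rule lborel_pair.Fubini_integrable)
    show "integrable lborel (\<lambda>t. LBINT u. norm (case (t, u) of (t, u) \<Rightarrow> char M t * (w u * iexp (- (t * u)))))"
      using int_char by (simp add: norm_mult)
    have "integrable lborel (\<lambda>u. char M t * (w u * iexp (- (t * u))))" for t
      by (intro integrable_mult_right Bochner_Integration.integrable_bound[OF w]) (auto simp: norm_mult)
    then show "AE t in lborel. integrable lborel (\<lambda>u. case (t, u) of (t, u) \<Rightarrow> char M t * (w u * iexp (- (t * u))))"
      by simp
  qed measurable
  then have "(CLBINT u. CLBINT t. char M t * (w u * iexp (- (t * u)))) = (CLBINT t. CLBINT u. char M t * (w u * iexp (- (t * u))))"
    using lborel_pair.Fubini_integral[of "\<lambda>t u. char M t * (w u * iexp (- (t * u)))"] by simp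
  also have "\<dots> = (CLBINT t. char M t * (CLBINT u. w u * iexp (- (t * u))))"
    by simp
  also have "(CLBINT u. CLBINT t. char M t * (w u * iexp (- (t * u)))) = (CLBINT u. w u * fourier_density M u) * (2 * pi)"
  proof -
    have "(CLBINT t. char M t * (w u * iexp (- (t * u)))) = w u * fourier_density M u * (2 * pi)" for u
    proof -
      have "(CLBINT t. char M t * (w u * iexp (- (t * u)))) = (CLBINT t. w u * (char M t * iexp (- (t * u))))"
        by (simp add: mult_ac)
      also have "\<dots> = w u * (CLBINT t. char M t * iexp (- (t * u)))"
        by (rule integral_mult_right_zero)
      finally show ?thesis
        by (simp add: fourier_density_def)
    qed
    then show ?thesis by simp
  qed
  finally show ?thesis
    by (simp add: eq_divide_eq)
qed

section \<open>The envelope of the covariance\<close>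

text \<open>
  The convolution of \<open>\<bar>char \<mu>\<bar>\<close> with the kernel \<open>1 / (1 + x\<^sup>2)\<close>, up to the reflection \<open>t \<mapsto> - t\<close> that
  comes from the sign in \<open>iexp (- (t * u))\<close>. Up to constants it bounds every smoothed covariance below.
\<close>

definition envelope :: "real measure \<Rightarrow> real \<Rightarrow> real" where
  "envelope \<mu> x = (LBINT t. cmod (char \<mu> t) * (1 / (1 + (x + t)\<^sup>2)))"

text \<open>
  On an interval of length one \<open>1 / (1 + z\<^sup>2)\<close> varies by a factor of at most \<open>3\<close>, so each term is at most
  \<open>3\<close> times an increment of \<open>arctan\<close>, and these telescope. The bound is uniform in the shift \<open>t\<close>,
  which is what makes the envelope summable.
\<close>

lemma sum_inverse_1_plus_square_le: "(\<Sum>j<n. 1 / (1 + (real j + t)\<^sup>2)) \<le> 3 * pi"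
proof -
  have step: "1 / (1 + (real j + t)\<^sup>2) \<le> 3 * (arctan (real (Suc j) + t) - arctan (real j + t))" for j
  proof -
    define e where "e = real j + t"
    obtain z where z: "e < z" "z < e + 1" and eq: "arctan (e + 1) - arctan e = (e + 1 - e) * (1 / (1 + z\<^sup>2))"
      using MVT2[of e "e + 1" arctan "\<lambda>z. 1 / (1 + z\<^sup>2)"] DERIV_arctan by (auto simp: inverse_eq_divide)
    define d where "d = z - e"
    have d: "0 < d" "d < 1" using z by (auto simp: d_def)
    have "z\<^sup>2 = e\<^sup>2 + 2 * e * d + d\<^sup>2"
      by (simp add: d_def power2_eq_square algebra_simps)
    also have "\<dots> \<le> 2 * e\<^sup>2 + 2 * d\<^sup>2"
      using sum_squares_bound[of e d] by simp
    also have "\<dots> \<le> 2 * e\<^sup>2 + 2"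
      using d by (simp add: power_le_one)
    also have "\<dots> \<le> 3 * e\<^sup>2 + 2"
      by simp
    finally have "1 + z\<^sup>2 \<le> 3 * (1 + e\<^sup>2)"
      by simp
    moreover have "0 < 1 + z\<^sup>2" "0 < 1 + e\<^sup>2" by (auto simp: add_pos_nonneg)
    ultimately have "1 / (1 + e\<^sup>2) \<le> 3 * (arctan (e + 1) - arctan e)"
      unfolding eq by (simp add: field_simps)
    then show ?thesis
      by (simp add: e_def add_ac)
  qed
  have "(\<Sum>j<n. 1 / (1 + (real j + t)\<^sup>2)) \<le> (\<Sum>j<n. 3 * (arctan (real (Suc j) + t) - arctan (real j + t)))"
    by (intro sum_mono step)
  also have "\<dots> = 3 * (arctan (real n + t) - arctan t)"
    unfolding sum_distrib_left[symmetric]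
    using sum_lessThan_telescope[of "\<lambda>j. arctan (real j + t)" n] by simp
  also have "\<dots> \<le> 3 * pi"
    using arctan_bounded[of "real n + t"] arctan_bounded[of t] by simp
  finally show ?thesis .
qed

lemma (in real_distribution) summable_envelope:
  assumes int_char: "integrable lborel (char M)"
  shows "summable (\<lambda>j. envelope M (real j))"
proof (rule summableI_nonneg_bounded)
  have int: "integrable lborel (\<lambda>t. cmod (char M t) * (1 / (1 + (x + t)\<^sup>2)))" for x
  proof (rule Bochner_Integration.integrable_bound[OF int_char])
    show "AE t in lborel. norm (cmod (char M t) * (1 / (1 + (x + t)\<^sup>2))) \<le> cmod (char M t)"
      by (auto simp: field_simps add_pos_nonneg intro!: AE_I2 mult_right_mono[of 1, simplified])
  qed simp
  show "0 \<le> envelope M (real j)" for j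
    by (auto simp: envelope_def intro!: Bochner_Integration.integral_nonneg)
  fix n
  have "(\<Sum>j<n. envelope M (real j)) = (LBINT t. (\<Sum>j<n. cmod (char M t) * (1 / (1 + (real j + t)\<^sup>2))))"
    unfolding envelope_def using int by (intro Bochner_Integration.integral_sum[symmetric]) auto
  also have "\<dots> \<le> (LBINT t. cmod (char M t) * (3 * pi))"
  proof (rule integral_mono)
    show "(\<Sum>j<n. cmod (char M t) * (1 / (1 + (real j + t)\<^sup>2))) \<le> cmod (char M t) * (3 * pi)" for t
      unfolding sum_distrib_left[symmetric] by (intro mult_left_mono sum_inverse_1_plus_square_le) auto
  qed (use int int_char in auto)
  finally show "(\<Sum>j<n. envelope M (real j)) \<le> (LBINT t. cmod (char M t) * (3 * pi))" .
qed

text \<open>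
  The measure \<open>\<rho>\<close> has density \<open>E\<close> with respect to \<open>M\<close>, so integrating \<open>v\<close> against \<open>\<rho>\<close> is integrating
  \<open>v * E\<close> against \<open>M\<close>. The decay of \<open>E\<close> may thus compensate a growth of \<open>v\<close>; Parseval's formula and
  the quadratic decay of the transform of \<open>v * E\<close> give the convolution.
\<close>

lemma (in real_distribution) norm_integral_density_le_envelope:
  fixes v E :: "real \<Rightarrow> real"
  assumes int_char: "integrable lborel (char M)"
    and \<rho>: "\<rho> = density M (\<lambda>u. ennreal (E u))" and E: "E \<in> borel_measurable borel" "\<And>u. 0 \<le> E u"
    and v: "v \<in> borel_measurable borel"
    and decay: "C2_dominated (\<lambda>u. B / (1 + u\<^sup>2)) (\<lambda>u. v u * E u) w' w''"
  shows "cmod (CLINT u|\<rho>. v u * iexp (- (x * u))) \<le> B * envelope M x"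
proof -
  note [measurable] = E(1) v measurable_fourier_density[OF int_char]
  have le: "\<bar>v u * E u\<bar> \<le> B / (1 + u\<^sup>2)" for u
    using decay by (auto simp: C2_dominated_def)
  have "0 \<le> B" using le[of 0] by simp
  have int_w: "integrable lborel (\<lambda>u. v u * E u)"
    by (rule integrable_of_inverse_square_bound(1)[OF _ le]) simp
  have int: "integrable lborel (\<lambda>u. complex_of_real (v u * E u) * iexp (- (x * u)))"
    by (rule Bochner_Integration.integrable_bound[OF int_w]) (auto simp: norm_mult)
  have "(CLINT u|\<rho>. v u * iexp (- (x * u))) = (CLINT u|M. E u *\<^sub>R (v u * iexp (- (x * u))))"
    unfolding \<rho> using E by (subst integral_density) auto
  also have "\<dots> = (CLBINT u. Re (fourier_density M u) *\<^sub>R (E u *\<^sub>R (v u * iexp (- (x * u)))))"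
    by (subst eq_density_fourier_density[OF int_char], subst integral_density)
       (auto simp: Re_fourier_density_nonneg[OF int_char])
  also have "\<dots> = (CLBINT u. complex_of_real (v u * E u) * iexp (- (x * u)) * fourier_density M u)"
    using Im_fourier_density_zero[OF int_char]
    by (intro Bochner_Integration.integral_cong refl) (simp add: complex_eq_iff)
  also have "\<dots> = (CLBINT t. char M t * (CLBINT u. complex_of_real (v u * E u) * iexp (- (x * u)) * iexp (- (t * u)))) / (2 * pi)"
    by (rule integral_mult_fourier_density[OF int_char int])
  also have "\<dots> = (CLBINT t. char M t * (CLBINT u. complex_of_real (v u * E u) * iexp (- ((x + t) * u)))) / (2 * pi)"
    by (simp add: mult.assoc distrib_right flip: exp_add) (simp add: algebra_simps)
  also have "cmod \<dots> \<le> (LBINT t. cmod (char M t * (CLBINT u. complex_of_real (v u * E u) * iexp (- ((x + t) * u))))) / (2 * pi)"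
    by (simp add: norm_divide divide_right_mono integral_norm_bound)
  also have "\<dots> \<le> (LBINT t. 2 * pi * B * (cmod (char M t) * (1 / (1 + (x + t)\<^sup>2)))) / (2 * pi)"
  proof (intro divide_right_mono Bochner_Integration.integral_mono')
    have "integrable lborel (\<lambda>t. cmod (char M t) * (1 / (1 + (x + t)\<^sup>2)))"
      by (rule Bochner_Integration.integrable_bound[OF int_char])
         (auto simp: field_simps add_pos_nonneg intro!: AE_I2)
    then show "integrable lborel (\<lambda>t. 2 * pi * B * (cmod (char M t) * (1 / (1 + (x + t)\<^sup>2))))"
      by (rule integrable_mult_right)
    show "cmod (char M t * (CLBINT u. complex_of_real (v u * E u) * iexp (- ((x + t) * u))))
         \<le> 2 * pi * B * (cmod (char M t) * (1 / (1 + (x + t)\<^sup>2)))" for t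
      using mult_left_mono[OF norm_fourier_integral_le[OF decay, of "x + t"] norm_ge_zero[of "char M t"]]
      by (simp add: norm_mult mult_ac)
  qed (use \<open>0 \<le> B\<close> in \<open>auto intro!: divide_nonneg_nonneg mult_nonneg_nonneg\<close>)
  also have "\<dots> = B * envelope M x"
    by (simp only: envelope_def integral_mult_right_zero) simp
  finally show ?thesis .
qed

section \<open>Multipliers\<close>

lemma C2_dominated_mono: "C2_dominated f w w' w'' \<Longrightarrow> (\<And>u. f u \<le> g u) \<Longrightarrow> C2_dominated g w w' w''"
  unfolding C2_dominated_def by (meson order_trans)

lemma C2_dominated_continuous:
  assumes "C2_dominated g w w' w''"
  shows "continuous_on UNIV w" "continuous_on UNIV w'" "continuous_on UNIV w''"
  using assms unfolding C2_dominated_def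
  by (meson DERIV_continuous continuous_at_imp_continuous_on)+

lemma C2_dominated_mult:
  assumes v: "C2_dominated f v v' v''" and w: "C2_dominated g w w' w''"
  shows "C2_dominated (\<lambda>u. 4 * (f u * g u)) (\<lambda>u. v u * w u) (\<lambda>u. v' u * w u + v u * w' u)
    (\<lambda>u. v'' u * w u + 2 * (v' u * w' u) + v u * w'' u)"
proof -
  have bnd: "\<bar>x * y\<bar> \<le> f u * g u" if "\<bar>x\<bar> \<le> f u" "\<bar>y\<bar> \<le> g u" for x y u :: real
    using that by (simp add: abs_mult mult_mono')
  have 1: "\<bar>v u * w u\<bar> \<le> f u * g u" "\<bar>v' u * w u\<bar> \<le> f u * g u" "\<bar>v u * w' u\<bar> \<le> f u * g u"
    "\<bar>v'' u * w u\<bar> \<le> f u * g u" "\<bar>v' u * w' u\<bar> \<le> f u * g u" "\<bar>v u * w'' u\<bar> \<le> f u * g u" for u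
    using v w by (auto intro!: bnd simp: C2_dominated_def)
  have nonneg: "0 \<le> f u * g u" for u
    using 1(1)[of u] by linarith
  have 2: "\<bar>v u * w u\<bar> \<le> 4 * (f u * g u)" "\<bar>v' u * w u + v u * w' u\<bar> \<le> 4 * (f u * g u)"
    "\<bar>v'' u * w u + 2 * (v' u * w' u) + v u * w'' u\<bar> \<le> 4 * (f u * g u)" for u
    using 1[of u] nonneg[of u] by (auto simp: abs_le_iff)
  have cont: "continuous_on UNIV (\<lambda>u. v'' u * w u + 2 * (v' u * w' u) + v u * w'' u)"
    by (intro continuous_intros C2_dominated_continuous[OF v] C2_dominated_continuous[OF w])
  have d1: "((\<lambda>u. v u * w u) has_real_derivative v' u * w u + v u * w' u) (at u)" for u
    using v w unfolding C2_dominated_def by (auto intro!: derivative_eq_intros)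
  have d2: "((\<lambda>u. v' u * w u + v u * w' u) has_real_derivative v'' u * w u + 2 * (v' u * w' u) + v u * w'' u) (at u)" for u
    by (rule derivative_eq_intros refl v[unfolded C2_dominated_def, THEN conjunct1, rule_format]
        v[unfolded C2_dominated_def, THEN conjunct2, THEN conjunct1, rule_format]
        w[unfolded C2_dominated_def, THEN conjunct1, rule_format]
        w[unfolded C2_dominated_def, THEN conjunct2, THEN conjunct1, rule_format])+ simp
  show ?thesis
    unfolding C2_dominated_def using d1 d2 cont 2 by auto
qed

lemma cosh_le_exp_abs: "cosh (x::real) \<le> exp \<bar>x\<bar>"
  by (simp add: cosh_def) (smt (verit, best) exp_le_cancel_iff field_sum_of_halves)

lemma abs_sinh_le: "\<bar>sinh x\<bar> \<le> \<bar>x\<bar> * cosh (x::real)"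
proof -
  have deriv: "(sinh has_real_derivative cosh z) (at z)" for z :: real
    by (auto intro!: derivative_eq_intros)
  have pos: "sinh x \<le> x * cosh x" if "0 < x" for x :: real
  proof -
    obtain z where z: "0 < z" "z < x" "sinh x - sinh 0 = (x - 0) * cosh z"
      using MVT2[of 0 x sinh cosh, OF \<open>0 < x\<close> deriv] by auto
    then show ?thesis using that by (simp add: cosh_real_nonneg_le_iff)
  qed
  show ?thesis
    using pos[of x] pos[of "-x"] by (cases "x > 0"; cases "x < 0") (auto simp: abs_if)
qed

lemma abs_sinhc_le: "\<bar>sinhc x\<bar> \<le> exp \<bar>x\<bar>"
proof (cases "x = 0")
  case False
  then have "\<bar>sinhc x\<bar> \<le> cosh x"
    using abs_sinh_le[of x] by (simp add: sinhc_def abs_mult divide_le_eq mult.commute)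
  then show ?thesis using cosh_le_exp_abs order_trans by blast
qed (simp add: sinhc_def)

lemma measurable_sinhc [measurable]: "sinhc \<in> borel_measurable borel"
proof -
  have "(\<lambda>u. if u = 0 then 1 else sinh u / u :: real) \<in> borel_measurable borel"
    unfolding sinh_def by measurable
  then show ?thesis by (simp add: sinhc_def[abs_def])
qed

text \<open>
  As a function of \<open>u\<close>, \<open>u * sinhc (u * y)\<close> is \<open>sinh (u * y) / y\<close>, and \<open>u\<close> for \<open>y = 0\<close>. Written through
  \<open>sinhc\<close> its bounds stay uniform as \<open>y\<close> tends to \<open>0\<close>.
\<close>

lemma C2_dominated_mult_sinhc:
  "C2_dominated (\<lambda>u. (1 + \<bar>y\<bar>) * (1 + \<bar>u\<bar>) * exp (\<bar>y\<bar> * \<bar>u\<bar>))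
     (\<lambda>u. u * sinhc (u * y)) (\<lambda>u. cosh (u * y)) (\<lambda>u. y * sinh (u * y))"
proof -
  have eq: "u * sinhc (u * y) = (if y = 0 then u else sinh (u * y) / y)" for u
    by (simp add: sinhc_def)
  have d: "((\<lambda>u. u * sinhc (u * y)) has_real_derivative cosh (u * y)) (at u)" for u
    unfolding eq by (cases "y = 0") (auto intro!: derivative_eq_intros)
  have e: "exp \<bar>u * y\<bar> = exp (\<bar>y\<bar> * \<bar>u\<bar>)" for u
    by (simp add: abs_mult mult.commute)
  have le: "x * exp (\<bar>y\<bar> * \<bar>u\<bar>) \<le> (1 + \<bar>y\<bar>) * (1 + \<bar>u\<bar>) * exp (\<bar>y\<bar> * \<bar>u\<bar>)"
    if "x \<le> 1 \<or> x \<le> \<bar>u\<bar> \<or> x \<le> \<bar>y\<bar>" for x u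
  proof (rule mult_right_mono)
    have "(1 + \<bar>y\<bar>) * (1 + \<bar>u\<bar>) = 1 + \<bar>y\<bar> + \<bar>u\<bar> + \<bar>y\<bar> * \<bar>u\<bar>"
      by (simp add: algebra_simps)
    moreover have "0 \<le> \<bar>y\<bar> * \<bar>u\<bar>" by simp
    ultimately show "x \<le> (1 + \<bar>y\<bar>) * (1 + \<bar>u\<bar>)" using that by linarith
  qed simp
  have "\<bar>u * sinhc (u * y)\<bar> \<le> \<bar>u\<bar> * exp (\<bar>y\<bar> * \<bar>u\<bar>)" for u
    using abs_sinhc_le[of "u * y"] by (simp add: abs_mult e mult_left_mono flip: e)
  moreover have "\<bar>cosh (u * y)\<bar> \<le> 1 * exp (\<bar>y\<bar> * \<bar>u\<bar>)" for u
    using cosh_le_exp_abs[of "u * y"] by (simp add: e)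
  moreover have "\<bar>y * sinh (u * y)\<bar> \<le> \<bar>y\<bar> * exp (\<bar>y\<bar> * \<bar>u\<bar>)" for u
  proof -
    have "\<bar>sinh (u * y)\<bar> \<le> cosh (u * y)"
      by (simp add: abs_le_iff sinh_def cosh_def field_simps)
    then show ?thesis
      using cosh_le_exp_abs[of "u * y"] unfolding e abs_mult by (simp add: abs_mult mult_left_mono mult.commute[of "\<bar>u\<bar>"])
  qed
  ultimately have bnds: "\<bar>u * sinhc (u * y)\<bar> \<le> (1 + \<bar>y\<bar>) * (1 + \<bar>u\<bar>) * exp (\<bar>y\<bar> * \<bar>u\<bar>)"
    "\<bar>cosh (u * y)\<bar> \<le> (1 + \<bar>y\<bar>) * (1 + \<bar>u\<bar>) * exp (\<bar>y\<bar> * \<bar>u\<bar>)"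
    "\<bar>y * sinh (u * y)\<bar> \<le> (1 + \<bar>y\<bar>) * (1 + \<bar>u\<bar>) * exp (\<bar>y\<bar> * \<bar>u\<bar>)" for u
    using le[of "\<bar>u\<bar>" u] le[of 1 u] le[of "\<bar>y\<bar>" u] order_trans by blast+
  have d2: "((\<lambda>u. cosh (u * y)) has_real_derivative y * sinh (u * y)) (at u)" for u
    by (auto intro!: derivative_eq_intros)
  have cont: "continuous_on UNIV (\<lambda>u. y * sinh (u * y))"
    by (intro continuous_intros)
  show ?thesis
    unfolding C2_dominated_def by (intro conjI allI d d2 cont bnds)
qed

lemma C2_dominated_one: "C2_dominated (\<lambda>_. 1) (\<lambda>_. 1) (\<lambda>_. 0) (\<lambda>_. 0)"
  by (auto simp: C2_dominated_def)

text \<open>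
  Up to a constant factor of modulus one, the covariance, the first derivative of \<open>r_smooth \<rho> 1 \<cdot> (2 * y)\<close>
  and the second derivative of \<open>r_smooth \<rho> 2 \<cdot> y\<close> are the integrals of \<open>iexp (- (x * u)) * v u\<close> over \<open>\<rho>\<close>
  for the three functions \<open>v\<close> below. The common bound depends on \<open>y\<close> only through \<open>c\<close>.
\<close>

lemma C2_dominated_multipliers:
  assumes c: "2 * \<bar>y\<bar> \<le> c"
  shows "C2_dominated (\<lambda>u. 8 * (1 + c)\<^sup>2 * (1 + u\<^sup>2) * exp (c * \<bar>u\<bar>)) (\<lambda>_. 1) (\<lambda>_. 0) (\<lambda>_. 0)" (is ?one)
    and "\<exists>v' v''. C2_dominated (\<lambda>u. 8 * (1 + c)\<^sup>2 * (1 + u\<^sup>2) * exp (c * \<bar>u\<bar>)) (\<lambda>u. u * sinhc (u * (2 * y))) v' v''" (is ?lin)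
    and "\<exists>v' v''. C2_dominated (\<lambda>u. 8 * (1 + c)\<^sup>2 * (1 + u\<^sup>2) * exp (c * \<bar>u\<bar>)) (\<lambda>u. (u * sinhc (u * y))\<^sup>2) v' v''" (is ?quad)
proof -
  have "0 \<le> c" using c by linarith
  have c2: "1 + c \<le> (1 + c)\<^sup>2" "1 \<le> (1 + c)\<^sup>2"
    using \<open>0 \<le> c\<close> by (auto simp: power2_eq_square algebra_simps)
  have u2: "1 + \<bar>u\<bar> \<le> 2 * (1 + u\<^sup>2)" "(1 + \<bar>u\<bar>)\<^sup>2 \<le> 2 * (1 + u\<^sup>2)" for u :: real
  proof -
    have "0 \<le> (1 - \<bar>u\<bar>)\<^sup>2" by simp
    then show *: "(1 + \<bar>u\<bar>)\<^sup>2 \<le> 2 * (1 + u\<^sup>2)"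
      by (simp add: power2_eq_square algebra_simps)
    have "1 + \<bar>u\<bar> \<le> (1 + \<bar>u\<bar>)\<^sup>2" by (simp add: power2_eq_square algebra_simps)
    with * show "1 + \<bar>u\<bar> \<le> 2 * (1 + u\<^sup>2)" by linarith
  qed
  show ?one
  proof (rule C2_dominated_mono[OF C2_dominated_one])
    fix u :: real
    have "1 * 1 * 1 \<le> 8 * (1 + c)\<^sup>2 * (1 + u\<^sup>2) * exp (c * \<bar>u\<bar>)"
      using c2 \<open>0 \<le> c\<close> by (intro mult_mono) auto
    then show "1 \<le> 8 * (1 + c)\<^sup>2 * (1 + u\<^sup>2) * exp (c * \<bar>u\<bar>)" by simp
  qed
  have "C2_dominated (\<lambda>u. 8 * (1 + c)\<^sup>2 * (1 + u\<^sup>2) * exp (c * \<bar>u\<bar>)) (\<lambda>u. u * sinhc (u * (2 * y)))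
      (\<lambda>u. cosh (u * (2 * y))) (\<lambda>u. 2 * y * sinh (u * (2 * y)))"
  proof (rule C2_dominated_mono[OF C2_dominated_mult_sinhc])
    fix u
    have "(1 + \<bar>2 * y\<bar>) * (1 + \<bar>u\<bar>) * exp (\<bar>2 * y\<bar> * \<bar>u\<bar>) \<le> (1 + c)\<^sup>2 * (2 * (1 + u\<^sup>2)) * exp (c * \<bar>u\<bar>)"
      using c c2 u2 \<open>0 \<le> c\<close> by (intro mult_mono mult_nonneg_nonneg) (auto simp: abs_mult mult_right_mono)
    also have "\<dots> = 2 * ((1 + c)\<^sup>2 * (1 + u\<^sup>2) * exp (c * \<bar>u\<bar>))"
      by (simp add: mult_ac)
    also have "\<dots> \<le> 8 * ((1 + c)\<^sup>2 * (1 + u\<^sup>2) * exp (c * \<bar>u\<bar>))"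
      by (intro mult_right_mono mult_nonneg_nonneg) auto
    also have "\<dots> = 8 * (1 + c)\<^sup>2 * (1 + u\<^sup>2) * exp (c * \<bar>u\<bar>)"
      by (simp add: mult_ac)
    finally show "(1 + \<bar>2 * y\<bar>) * (1 + \<bar>u\<bar>) * exp (\<bar>2 * y\<bar> * \<bar>u\<bar>) \<le> 8 * (1 + c)\<^sup>2 * (1 + u\<^sup>2) * exp (c * \<bar>u\<bar>)" .
  qed
  then show ?lin by blast
  have *: "4 * ((1 + \<bar>y\<bar>) * (1 + \<bar>u\<bar>) * exp (\<bar>y\<bar> * \<bar>u\<bar>) * ((1 + \<bar>y\<bar>) * (1 + \<bar>u\<bar>) * exp (\<bar>y\<bar> * \<bar>u\<bar>)))
      \<le> 8 * (1 + c)\<^sup>2 * (1 + u\<^sup>2) * exp (c * \<bar>u\<bar>)" for u :: real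
  proof -
    have "4 * ((1 + \<bar>y\<bar>) * (1 + \<bar>u\<bar>) * exp (\<bar>y\<bar> * \<bar>u\<bar>) * ((1 + \<bar>y\<bar>) * (1 + \<bar>u\<bar>) * exp (\<bar>y\<bar> * \<bar>u\<bar>)))
       = 4 * ((1 + \<bar>y\<bar>)\<^sup>2 * (1 + \<bar>u\<bar>)\<^sup>2 * exp (2 * \<bar>y\<bar> * \<bar>u\<bar>))"
    proof -
      have "exp (2 * \<bar>y\<bar> * \<bar>u\<bar>) = exp (\<bar>y\<bar> * \<bar>u\<bar>) * exp (\<bar>y\<bar> * \<bar>u\<bar>)"
        by (simp flip: exp_add)
      then show ?thesis by (simp add: power2_eq_square mult_ac)
    qed
    also have "\<dots> \<le> 4 * ((1 + c)\<^sup>2 * (2 * (1 + u\<^sup>2)) * exp (c * \<bar>u\<bar>))"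
      using c u2 \<open>0 \<le> c\<close> by (intro mult_left_mono mult_mono power_mono mult_nonneg_nonneg) (auto simp: mult_right_mono)
    finally show ?thesis by (simp only: mult_ac)
  qed
  show ?quad
    unfolding power2_eq_square
    using C2_dominated_mono[OF C2_dominated_mult[OF C2_dominated_mult_sinhc C2_dominated_mult_sinhc] *]
    by (auto simp: power2_eq_square)
qed

lemma power_le_fact_exp: "0 \<le> x \<Longrightarrow> x ^ n \<le> fact n * exp (x::real)"
proof -
  assume "0 \<le> x"
  have "(\<Sum>k\<in>{n}. x ^ k /\<^sub>R fact k) \<le> exp x"
    unfolding exp_def using \<open>0 \<le> x\<close> by (intro sum_le_suminf summable_exp_generic) auto
  then show ?thesis by (simp add: field_simps)
qed

lemma abs_power_le_exp:
  assumes "0 < \<delta>"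
  shows "\<bar>u\<bar> ^ n \<le> fact n / \<delta> ^ n * exp (\<delta> * \<bar>u::real\<bar>)"
  using power_le_fact_exp[of "\<delta> * \<bar>u\<bar>" n] assms by (simp add: power_mult_distrib field_simps)

lemma inverse_square_bound_of_exp:
  assumes "0 < c"
  obtains K where "0 \<le> K" "\<And>u::real. (1 + u\<^sup>2) * exp (- (c * \<bar>u\<bar>)) \<le> K / (1 + u\<^sup>2)"
proof
  define K where "K = 2 + 2 * (fact 4 / c ^ 4)"
  show "0 \<le> K" using assms by (simp add: K_def)
  fix u :: real
  have "(1 + u\<^sup>2)\<^sup>2 \<le> 2 + 2 * \<bar>u\<bar> ^ 4"
    using zero_le_power2[of "1 - u\<^sup>2"] by (simp add: power2_eq_square power4_eq_xxxx algebra_simps)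
  also have "\<dots> \<le> 2 * exp (c * \<bar>u\<bar>) + 2 * (fact 4 / c ^ 4 * exp (c * \<bar>u\<bar>))"
    using abs_power_le_exp[OF assms, of u 4] assms by (intro add_mono mult_left_mono) auto
  also have "\<dots> = K * exp (c * \<bar>u\<bar>)"
    by (simp add: K_def algebra_simps)
  finally have "(1 + u\<^sup>2)\<^sup>2 * exp (- (c * \<bar>u\<bar>)) \<le> K"
    by (simp add: exp_minus field_simps)
  then show "(1 + u\<^sup>2) * exp (- (c * \<bar>u\<bar>)) \<le> K / (1 + u\<^sup>2)"
    by (simp add: pos_le_divide_eq add_pos_nonneg power2_eq_square mult_ac)
qed

section \<open>Differentiation of the smoothed covariances\<close>

lemma integrable_power_mult_exp:
  fixes \<rho> :: "real measure"
  assumes [measurable_cong]: "sets \<rho> = sets borel" and int: "integrable \<rho> (\<lambda>u. exp (\<bar>u\<bar> * \<kappa>))" and \<delta>: "\<delta> < \<kappa>"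
    and [measurable]: "h \<in> borel_measurable borel" and le: "\<And>u. \<bar>h u\<bar> \<le> \<bar>u\<bar> ^ n * exp (\<delta> * \<bar>u\<bar>)"
  shows "integrable \<rho> (h :: real \<Rightarrow> real)"
proof -
  let ?C = "fact n / (\<kappa> - \<delta>) ^ n"
  have "integrable \<rho> (\<lambda>u. ?C * exp (\<bar>u\<bar> * \<kappa>))"
    using int by simp
  then show ?thesis
  proof (rule Bochner_Integration.integrable_bound)
    have "\<bar>h u\<bar> \<le> ?C * exp (\<bar>u\<bar> * \<kappa>)" for u
    proof -
      have "\<bar>h u\<bar> \<le> ?C * exp ((\<kappa> - \<delta>) * \<bar>u\<bar>) * exp (\<delta> * \<bar>u\<bar>)"
        using abs_power_le_exp[of "\<kappa> - \<delta>" u n] \<delta> by (intro order_trans[OF le] mult_right_mono) auto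
      also have "\<dots> = ?C * exp (\<bar>u\<bar> * \<kappa>)"
        by (simp add: algebra_simps flip: exp_add)
      finally show ?thesis .
    qed
    then show "AE u in \<rho>. norm (h u) \<le> norm (?C * exp (\<bar>u\<bar> * \<kappa>))"
      using \<delta> by (auto intro: order_trans[OF _ abs_ge_self])
  qed measurable
qed

text \<open>
  The second order Taylor estimate of the exponential bounds the remainder of the difference quotient by
  \<open>\<bar>y - x\<bar>\<close> times the second absolute moment of \<open>h\<close>.
\<close>

lemma has_vector_derivative_fourier_integral:
  fixes \<rho> :: "real measure" and h :: "real \<Rightarrow> complex"
  assumes [measurable_cong]: "sets \<rho> = sets borel"
    and h: "integrable \<rho> h" and h1: "integrable \<rho> (\<lambda>u. u * h u)" and h2: "integrable \<rho> (\<lambda>u. u\<^sup>2 * h u)"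
  shows "((\<lambda>x. CLINT u|\<rho>. exp (- \<i> * u * x) * h u) has_vector_derivative
           (CLINT u|\<rho>. exp (- \<i> * u * x) * (- \<i> * u * h u))) (at x)"
  unfolding has_vector_derivative_def
proof (rule has_derivativeI_sandwich[where e=1])
  have [measurable]: "h \<in> borel_measurable borel"
    using h by (simp add: borel_measurable_integrable measurable_cong_sets[OF assms(1) refl, symmetric])
  let ?D = "CLINT u|\<rho>. exp (- \<i> * u * x) * (- \<i> * u * h u)"
  let ?C = "LINT u|\<rho>. cmod (u\<^sup>2 * h u)"
  have exp_norm: "cmod (exp (- \<i> * complex_of_real u * complex_of_real y)) = 1" for u y :: real
    using norm_exp_i_times[of "- (u * y)"] by (simp add: mult_ac)
  have i0: "integrable \<rho> (\<lambda>u. exp (- \<i> * u * y) * h u)" for y :: real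
    by (rule Bochner_Integration.integrable_bound[OF h]) (auto simp: norm_mult exp_norm)
  have i1: "integrable \<rho> (\<lambda>u. exp (- \<i> * u * x) * (- \<i> * u * h u))"
    by (rule Bochner_Integration.integrable_bound[OF h1]) (auto simp: norm_mult exp_norm)
  show "bounded_linear (\<lambda>z. z *\<^sub>R ?D)" by (rule bounded_linear_scaleR_left)
  fix y :: real
  assume "y \<noteq> x"
  have "(CLINT u|\<rho>. exp (- \<i> * u * y) * h u) - (CLINT u|\<rho>. exp (- \<i> * u * x) * h u) - (y - x) *\<^sub>R ?D
     = (CLINT u|\<rho>. (exp (- \<i> * u * y) * h u) - (exp (- \<i> * u * x) * h u) - (y - x) *\<^sub>R (exp (- \<i> * u * x) * (- \<i> * u * h u)))"
    using i0 i1 by simp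
  also have "cmod \<dots> \<le> (LINT u|\<rho>. (y - x)\<^sup>2 * cmod (u\<^sup>2 * h u))"
  proof (rule order_trans[OF integral_norm_bound], rule integral_mono)
    fix u
    have "(exp (- \<i> * u * y) * h u) - (exp (- \<i> * u * x) * h u) - (y - x) *\<^sub>R (exp (- \<i> * u * x) * (- \<i> * u * h u))
      = exp (- \<i> * u * x) * h u * (iexp (- (u * (y - x))) - (\<Sum>k\<le>1. (\<i> * complex_of_real (- (u * (y - x)))) ^ k / fact k))"
    proof -
      have "exp (- \<i> * u * y) = exp (- \<i> * u * x) * iexp (- (u * (y - x)))"
        by (simp flip: exp_add add: algebra_simps)
      then show ?thesis
        by (simp add: scaleR_conv_of_real algebra_simps)
    qed
    also have "cmod \<dots> \<le> cmod (h u) * (\<bar>- (u * (y - x))\<bar> ^ Suc 1 / fact (Suc 1))"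
      unfolding norm_mult exp_norm mult_1_left by (intro mult_left_mono iexp_approx1 norm_ge_zero)
    also have "\<dots> \<le> (y - x)\<^sup>2 * cmod (u\<^sup>2 * h u)"
    proof -
      have "cmod (h u) * (\<bar>- (u * (y - x))\<bar> ^ Suc 1 / fact (Suc 1)) = cmod (h u) * (u\<^sup>2 * (y - x)\<^sup>2 / 2)"
        by (simp add: numeral_2_eq_2[symmetric] power_mult_distrib)
      also have "\<dots> \<le> cmod (h u) * (u\<^sup>2 * (y - x)\<^sup>2)"
        by (intro mult_left_mono) auto
      finally show ?thesis
        by (simp add: norm_mult norm_power mult_ac)
    qed
    finally show "cmod ((exp (- \<i> * u * y) * h u) - (exp (- \<i> * u * x) * h u) - (y - x) *\<^sub>R (exp (- \<i> * u * x) * (- \<i> * u * h u)))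
        \<le> (y - x)\<^sup>2 * cmod (u\<^sup>2 * h u)" .
  qed (use i0 i1 h2 in auto)
  also have "\<dots> = (y - x)\<^sup>2 * ?C" by simp
  finally show "norm ((CLINT u|\<rho>. exp (- \<i> * u * y) * h u) - (CLINT u|\<rho>. exp (- \<i> * u * x) * h u) - (y - x) *\<^sub>R ?D) / norm (y - x)
     \<le> \<bar>y - x\<bar> * ?C"
    using \<open>y \<noteq> x\<close> by (simp add: divide_le_eq power2_eq_square mult_ac flip: abs_mult)
next
  show "((\<lambda>y. \<bar>y - x\<bar> * (LINT u|\<rho>. cmod (u\<^sup>2 * h u))) \<longlongrightarrow> 0) (at x)"
    by (auto intro!: tendsto_eq_intros)
qed simp

lemma exp_minus_i_eq_iexp: "exp (- \<i> * complex_of_real u * complex_of_real x) = iexp (- (x * u))"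
  by (simp add: mult_ac)

context
  fixes \<rho> :: "real measure" and \<kappa> :: real
  assumes sets_\<rho>: "sets \<rho> = sets borel" and exp_moment: "integrable \<rho> (\<lambda>u. exp (\<bar>u\<bar> * \<kappa>))"
begin

lemma integrable_power_mult_sinhc_power:
  assumes "l * \<bar>y\<bar> < \<kappa>"
  shows "integrable \<rho> (\<lambda>u. u ^ n * sinhc (u * y) ^ l)"
proof (rule integrable_power_mult_exp[OF sets_\<rho> exp_moment assms])
  fix u
  have "\<bar>sinhc (u * y)\<bar> ^ l \<le> exp \<bar>u * y\<bar> ^ l"
    by (intro power_mono abs_sinhc_le) auto
  also have "\<dots> = exp (real l * \<bar>y\<bar> * \<bar>u\<bar>)"
    by (simp add: abs_mult mult_ac flip: exp_of_nat_mult)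
  finally show "\<bar>u ^ n * sinhc (u * y) ^ l\<bar> \<le> \<bar>u\<bar> ^ n * exp (real l * \<bar>y\<bar> * \<bar>u\<bar>)"
    by (simp add: abs_mult power_abs mult_left_mono)
qed measurable

lemma has_vector_derivative_sinhc_integral:
  assumes "l * \<bar>y\<bar> < \<kappa>"
  shows "((\<lambda>x. CLINT u|\<rho>. exp (- \<i> * u * x) * ((- \<i> * u) ^ n * (sinhc (u * y) ^ l)))
    has_vector_derivative (CLINT u|\<rho>. exp (- \<i> * u * x) * ((- \<i> * u) ^ Suc n * (sinhc (u * y) ^ l)))) (at x)"
proof -
  have int: "integrable \<rho> (\<lambda>u. complex_of_real u ^ k * ((- \<i> * u) ^ n * (sinhc (u * y) ^ l)))" for k
  proof -
    have "integrable \<rho> (\<lambda>u. (- \<i>) ^ n * complex_of_real (u ^ (k + n) * sinhc (u * y) ^ l))"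
      using integrable_power_mult_sinhc_power[OF assms, of "k + n"]
      by (intro integrable_mult_right) (simp only: complex_of_real_integrable_eq)
    then show ?thesis
      unfolding power_mult_distrib of_real_mult of_real_power power_add by (simp only: mult_ac)
  qed
  have "integrable \<rho> (\<lambda>u. (- \<i> * u) ^ n * complex_of_real (sinhc (u * y) ^ l))"
    "integrable \<rho> (\<lambda>u. u * ((- \<i> * u) ^ n * complex_of_real (sinhc (u * y) ^ l)))"
    "integrable \<rho> (\<lambda>u. u\<^sup>2 * ((- \<i> * u) ^ n * complex_of_real (sinhc (u * y) ^ l)))"
    using int[of 0] int[of 1] int[of 2] by simp_all
  from has_vector_derivative_fourier_integral[OF sets_\<rho> this, of x] show ?thesis
    by (simp add: mult.assoc)
qed

lemma r1_deriv_eq: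
  assumes "\<bar>y\<bar> < \<kappa>"
  shows "r1_deriv \<rho> x y = - \<i> * (CLINT u|\<rho>. (u * sinhc (u * y)) * iexp (- (x * u)))"
proof -
  have "r1_deriv \<rho> x y = (CLINT u|\<rho>. exp (- \<i> * u * x) * ((- \<i> * u) ^ Suc 0 * (sinhc (u * y) ^ 1)))"
    unfolding r1_deriv_def r_smooth_def
    using has_vector_derivative_sinhc_integral[of 1 y 0 x] assms by (intro vector_derivative_at) simp
  also have "\<dots> = (CLINT u|\<rho>. - \<i> * ((u * sinhc (u * y)) * iexp (- (x * u))))"
    by (intro Bochner_Integration.integral_cong refl, subst exp_minus_i_eq_iexp) simp
  finally show ?thesis by (simp only: integral_mult_right_zero)
qed

lemma r2_deriv2_eq:
  assumes "2 * \<bar>y\<bar> < \<kappa>"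
  shows "r2_deriv2 \<rho> x y = - (CLINT u|\<rho>. ((u * sinhc (u * y))\<^sup>2) * iexp (- (x * u)))"
proof -
  have "vector_derivative (\<lambda>z. r_smooth \<rho> 2 z y) (at w)
    = (CLINT u|\<rho>. exp (- \<i> * u * w) * ((- \<i> * u) ^ Suc 0 * (sinhc (u * y) ^ 2)))" for w
    unfolding r_smooth_def
    using has_vector_derivative_sinhc_integral[of 2 y 0 w] assms by (intro vector_derivative_at) simp
  then have "r2_deriv2 \<rho> x y = (CLINT u|\<rho>. exp (- \<i> * u * x) * ((- \<i> * u) ^ Suc (Suc 0) * (sinhc (u * y) ^ 2)))"
    unfolding r2_deriv2_def
    using has_vector_derivative_sinhc_integral[of 2 y "Suc 0" x] assms by (intro vector_derivative_at) simp
  also have "\<dots> = (CLINT u|\<rho>. - (((u * sinhc (u * y))\<^sup>2) * iexp (- (x * u))))"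
    by (intro Bochner_Integration.integral_cong refl, subst exp_minus_i_eq_iexp)
       (simp add: power2_eq_square mult_ac)
  finally show ?thesis by simp
qed

end

section \<open>A criterion for Assumption A\<close>

lemma infsum_atLeast_le_suminf:
  fixes f :: "nat \<Rightarrow> ennreal"
  assumes le: "\<And>j. f j \<le> ennreal (g j)" and g: "\<And>j. 0 \<le> g j" "summable g"
  shows "infsum f {k..} \<le> ennreal (\<Sum>j. g (j + k))"
  unfolding nonneg_infsum_complete[OF zero_le]
proof (rule SUP_least)
  fix F assume F: "F \<in> {F. finite F \<and> F \<subseteq> {k..}}"
  have "sum f F \<le> (\<Sum>j\<in>F. ennreal (g j))"
    by (intro sum_mono le)
  also have "\<dots> = ennreal (\<Sum>j\<in>F. g j)"
    using g by (intro sum_ennreal) auto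
  also have "(\<Sum>j\<in>F. g j) = (\<Sum>j\<in>(\<lambda>j. j - k) ` F. g (j + k))"
    using F by (subst sum.reindex) (auto intro!: sum.cong inj_onI simp: subset_eq, metis le_add_diff_inverse2)
  also have "\<dots> \<le> (\<Sum>j. g (j + k))"
    using F g by (intro sum_le_suminf summable_ignore_initial_segment) auto
  finally show "sum f F \<le> ennreal (\<Sum>j. g (j + k))"
    by (simp add: ennreal_leI)
qed

text \<open>
  Both cases of the proposition are instances: \<open>\<mu>\<close> has an integrable characteristic function, and \<open>\<rho>\<close> is
  \<open>\<mu>\<close> reweighted by a smooth exponentially decaying \<open>E\<close>. The decay rate \<open>a\<close> of \<open>E\<close> leaves room for
  multipliers growing at rate \<open>c = a / 2\<close>: their product with \<open>E\<close> still decays at rate \<open>c\<close>. A multiplier with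
  parameter \<open>\<bar>y\<bar> < \<kappa>'\<close> grows at rate at most \<open>2 * \<kappa>'\<close>, whence the choice \<open>\<kappa>' = a / 4\<close>. The three sequences in
  \<open>omega_star\<close> are then bounded, uniformly in \<open>y\<close>, by a constant times the envelope at the integers
  (\<open>1\<close> is the spacing), and tails of a convergent series vanish.
\<close>

theorem assumption_A_and_density_criterion:
  assumes \<mu>: "real_distribution \<mu>" and int_char: "integrable lborel (char \<mu>)"
    and \<rho>: "\<rho> = density \<mu> (\<lambda>u. ennreal (E u))" and E_nonneg: "\<And>u. 0 \<le> E u"
    and E: "C2_dominated (\<lambda>u. C * exp (- (a * \<bar>u\<bar>))) E E' E''"
    and a: "0 < a" "a < \<kappa>" and exp_moment: "integrable \<rho> (\<lambda>u. exp (\<bar>u\<bar> * \<kappa>))"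
  shows "assumption_A \<rho> \<and> has_bounded_continuous_density \<rho>"
proof -
  interpret \<mu>: real_distribution \<mu> by fact
  have [measurable]: "E \<in> borel_measurable borel"
    by (intro borel_measurable_continuous_onI C2_dominated_continuous[OF E])
  note [measurable] = \<mu>.measurable_fourier_density[OF int_char]
  have sets_\<rho>: "sets \<rho> = sets borel"
    by (simp add: \<rho>)
  have "0 \<le> C"
    using E unfolding C2_dominated_def by (auto dest!: spec[of _ "0::real"])

  define p where "p u = Re (fourier_density \<mu> u) * E u" for u
  have p_nonneg: "0 \<le> p u" for u
    by (simp add: p_def \<mu>.Re_fourier_density_nonneg[OF int_char] E_nonneg)
  have p_cont: "continuous_on UNIV p"
    unfolding p_def by (intro continuous_intros C2_dominated_continuous[OF E] \<mu>.continuous_on_fourier_density[OF int_char])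
  have \<rho>_p: "\<rho> = density lborel (\<lambda>x. ennreal (p x))"
    unfolding p_def \<rho> by (subst \<mu>.eq_density_fourier_density[OF int_char], subst density_density_eq)
      (auto simp: ennreal_mult' \<mu>.Re_fourier_density_nonneg[OF int_char])
  have bounded: "bounded (range p)"
  proof (rule boundedI)
    fix z assume "z \<in> range p"
    then obtain u where z: "z = p u" by auto
    have "\<bar>E u\<bar> \<le> C * exp (- (a * \<bar>u\<bar>))"
      using E by (simp add: C2_dominated_def)
    also have "\<dots> \<le> C * 1"
      using a \<open>0 \<le> C\<close> by (intro mult_left_mono) auto
    finally have "\<bar>E u\<bar> \<le> C" by simp
    moreover have "\<bar>Re (fourier_density \<mu> u)\<bar> \<le> (LBINT t. cmod (char \<mu> t)) / (2 * pi)"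
      using order_trans[OF abs_Re_le_cmod norm_fourier_density_le[OF int_char]] .
    ultimately show "norm z \<le> (LBINT t. cmod (char \<mu> t)) / (2 * pi) * C"
      unfolding z p_def real_norm_def abs_mult by (intro mult_mono') auto
  qed
  have density: "has_bounded_continuous_density \<rho>"
    unfolding has_bounded_continuous_density_def using p_nonneg p_cont \<rho>_p bounded by blast
  have [measurable]: "p \<in> borel_measurable borel"
    using p_cont by (rule borel_measurable_continuous_onI)
  have non_atomic: "emeasure \<rho> {x} = 0" for x
    unfolding \<rho>_p by (subst emeasure_density) (auto simp: nn_integral_0_iff_AE intro!: AE_I[of _ _ "{x}"])

  define c where "c = a / 2"
  have "0 < c" using a by (simp add: c_def)
  obtain K where K: "0 \<le> K" "\<And>u::real. (1 + u\<^sup>2) * exp (- (c * \<bar>u\<bar>)) \<le> K / (1 + u\<^sup>2)"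
    using inverse_square_bound_of_exp[OF \<open>0 < c\<close>] by blast
  define A where "A = 8 * (1 + c)\<^sup>2"
  define B where "B = 4 * A * C * K"
  have "0 \<le> A" by (simp add: A_def)
  then have "0 \<le> B" using K \<open>0 \<le> C\<close> by (simp add: B_def)
  have fourier_le: "cmod (CLINT u|\<rho>. v u * iexp (- (x * u))) \<le> B * envelope \<mu> x"
    if v: "C2_dominated (\<lambda>u. A * (1 + u\<^sup>2) * exp (c * \<bar>u\<bar>)) v v' v''" for v v' v'' x
  proof (rule \<mu>.norm_integral_density_le_envelope[OF int_char \<rho> _ E_nonneg])
    show "v \<in> borel_measurable borel"
      by (intro borel_measurable_continuous_onI C2_dominated_continuous[OF v])
    show "C2_dominated (\<lambda>u. B / (1 + u\<^sup>2)) (\<lambda>u. v u * E u) (\<lambda>u. v' u * E u + v u * E' u)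
        (\<lambda>u. v'' u * E u + 2 * (v' u * E' u) + v u * E'' u)"
    proof (rule C2_dominated_mono[OF C2_dominated_mult[OF v E]])
      fix u
      have exps: "exp (c * \<bar>u\<bar>) * exp (- (a * \<bar>u\<bar>)) = exp (- (c * \<bar>u\<bar>))"
        by (simp add: c_def flip: exp_add)
      have "4 * (A * (1 + u\<^sup>2) * exp (c * \<bar>u\<bar>) * (C * exp (- (a * \<bar>u\<bar>))))
          = 4 * A * C * ((1 + u\<^sup>2) * exp (- (c * \<bar>u\<bar>)))"
        unfolding exps[symmetric] by (simp only: mult_ac)
      also have "\<dots> \<le> 4 * A * C * (K / (1 + u\<^sup>2))"
        using K \<open>0 \<le> C\<close> \<open>0 \<le> A\<close> by (intro mult_left_mono) auto
      finally show "4 * (A * (1 + u\<^sup>2) * exp (c * \<bar>u\<bar>) * (C * exp (- (a * \<bar>u\<bar>)))) \<le> B / (1 + u\<^sup>2)"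
        by (simp add: B_def)
    qed
  qed measurable

  let ?\<kappa>' = "a / 4"
  have y: "2 * \<bar>y\<bar> \<le> c" "\<bar>2 * y\<bar> < \<kappa>" "2 * \<bar>y\<bar> < \<kappa>" if "\<bar>y\<bar> < ?\<kappa>'" for y
    using that a by (auto simp: c_def)
  have ft: "cmod (fourier_transform \<rho> x) \<le> B * envelope \<mu> x" for x
  proof -
    have "fourier_transform \<rho> x = (CLINT u|\<rho>. 1 * iexp (- (x * u)))"
      unfolding fourier_transform_def by (intro Bochner_Integration.integral_cong refl) (simp add: mult_ac)
    then show ?thesis
      using fourier_le[OF C2_dominated_multipliers(1)[of 0 c, folded A_def], of x] \<open>0 < c\<close> by simp
  qed
  have r1: "cmod (r1_deriv \<rho> x (2 * y)) \<le> B * envelope \<mu> x" if y_lt: "\<bar>y\<bar> < ?\<kappa>'" for x y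
  proof -
    obtain v' v'' where v: "C2_dominated (\<lambda>u. A * (1 + u\<^sup>2) * exp (c * \<bar>u\<bar>)) (\<lambda>u. u * sinhc (u * (2 * y))) v' v''"
      using C2_dominated_multipliers(2)[OF y(1)[OF y_lt]] by (auto simp: A_def)
    show ?thesis
      using fourier_le[OF v, of x] r1_deriv_eq[OF sets_\<rho> exp_moment y(2)[OF y_lt], of x] by (simp add: norm_mult)
  qed
  have r2: "cmod (r2_deriv2 \<rho> x y) \<le> B * envelope \<mu> x" if y_lt: "\<bar>y\<bar> < ?\<kappa>'" for x y
  proof -
    obtain v' v'' where v: "C2_dominated (\<lambda>u. A * (1 + u\<^sup>2) * exp (c * \<bar>u\<bar>)) (\<lambda>u. (u * sinhc (u * y))\<^sup>2) v' v''"
      using C2_dominated_multipliers(3)[OF y(1)[OF y_lt]] by (auto simp: A_def)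
    show ?thesis
      using fourier_le[OF v, of x] r2_deriv2_eq[OF sets_\<rho> exp_moment y(3)[OF y_lt], of x] by simp
  qed

  define g where "g j = B * envelope \<mu> (real j)" for j
  have g_nonneg: "0 \<le> g j" for j
    unfolding g_def using \<open>0 \<le> B\<close> by (auto simp: envelope_def intro!: mult_nonneg_nonneg Bochner_Integration.integral_nonneg)
  have g_summable: "summable g"
    unfolding g_def using \<mu>.summable_envelope[OF int_char] by (rule summable_mult)
  define R where "R k = ennreal (\<Sum>j. g (j + k))" for k
  have omega_le: "omega_star \<rho> ?\<kappa>' 1 k \<le> R k + (R k + R k)" for k
    unfolding omega_star_def R_def
    using ft r1 r2
    by (intro add_mono SUP_least infsum_atLeast_le_suminf g_nonneg g_summable)
       (simp_all add: g_def ennreal_leI del: ennreal_le_iff)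
  have "(\<lambda>k. \<Sum>j. g (j + k)) \<longlonglongrightarrow> 0"
    using suminf_exist_split2[OF g_summable] .
  then have R: "R \<longlonglongrightarrow> ennreal 0"
    unfolding R_def by (rule tendsto_ennrealI)
  have R3: "(\<lambda>k. R k + (R k + R k)) \<longlonglongrightarrow> 0"
    using tendsto_add[OF R tendsto_add[OF R R]] by simp
  have "omega_star \<rho> ?\<kappa>' 1 \<longlonglongrightarrow> 0"
    by (rule tendsto_sandwich[OF _ _ tendsto_const R3]) (use omega_le in \<open>auto intro: always_eventually\<close>)
  then have "assumption_A \<rho>"
    unfolding assumption_A_def using a non_atomic exp_moment
    by (intro conjI allI exI[of _ \<kappa>] exI[of _ ?\<kappa>'] exI[of _ 1]) auto
  with density show ?thesis by simp
qed

section \<open>Compact support and exponential moments\<close>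

lemma has_real_derivative_pos_part_power:
  "((\<lambda>v. max 0 v ^ Suc (Suc n)) has_real_derivative real (Suc (Suc n)) * max 0 x ^ Suc n) (at x)"
proof -
  consider "x < 0" | "x = 0" | "0 < x" by linarith
  then show ?thesis
  proof cases
    case 1
    have "((\<lambda>_. 0 :: real) has_real_derivative 0) (at x)" by simp
    then have "((\<lambda>v. max 0 v ^ Suc (Suc n)) has_real_derivative 0) (at x)"
      by (rule has_field_derivative_transform_within_open[where S="{..<0}"]) (use 1 in auto)
    then show ?thesis using 1 by simp
  next
    case 2
    have "continuous_on UNIV (\<lambda>v::real. max 0 v ^ Suc n)"
      by (intro continuous_intros)
    then have "isCont (\<lambda>v::real. max 0 v ^ Suc n) 0"
      by (simp add: continuous_on_eq_continuous_at del: power_Suc)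
    then show ?thesis
      unfolding CARAT_DERIV using 2
      by (intro exI[of _ "\<lambda>v. max 0 v ^ Suc n"]) (auto simp: max_def)
  next
    case 3
    have "((\<lambda>v. v ^ Suc (Suc n)) has_real_derivative real (Suc (Suc n)) * x ^ Suc n) (at x)"
      using DERIV_pow[of "Suc (Suc n)" x] by simp
    then have "((\<lambda>v. max 0 v ^ Suc (Suc n)) has_real_derivative real (Suc (Suc n)) * x ^ Suc n) (at x)"
      by (rule has_field_derivative_transform_within_open[where S="{0<..}"]) (use 3 in auto)
    then show ?thesis using 3 by simp
  qed
qed

text \<open>
  The cube \<open>q\<close> of the positive part is \<open>C\<^sup>2\<close>, hence so is \<open>E u = 1 - q (1 - q (\<beta> u))\<close>. Where \<open>\<beta> u \<ge> 1\<close>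
  the inner difference is at most \<open>0\<close> and \<open>E u = 1\<close>; where \<open>\<beta> u \<le> 0\<close> it is \<open>1\<close> and \<open>E u = 0\<close>. With
  \<open>\<beta> u = L\<^sup>2 + 1 - u\<^sup>2\<close> this is a cutoff that is \<open>1\<close> on \<open>[-L, L]\<close>; continuous functions with compact support
  are dominated by any multiple of \<open>exp (- \<bar>u\<bar>)\<close> that is large enough.
\<close>

lemma C2_cutoff:
  assumes "0 \<le> L"
  obtains E E' E'' :: "real \<Rightarrow> real" and C where
    "C2_dominated (\<lambda>u. C * exp (- (1 * \<bar>u\<bar>))) E E' E''" "\<And>u. 0 \<le> E u" "\<And>u. \<bar>u\<bar> \<le> L \<Longrightarrow> E u = 1"
proof -
  define q where "q v = max 0 v ^ 3" for v :: real
  define q' where "q' v = 3 * max 0 v ^ 2" for v :: real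
  define q'' where "q'' v = 6 * max 0 v" for v :: real
  define \<beta> where "\<beta> u = L\<^sup>2 + 1 - u\<^sup>2" for u :: real
  have q: "(q has_real_derivative q' v) (at v)" for v
    using has_real_derivative_pos_part_power[of 1 v] by (simp add: q_def[abs_def] q'_def numeral_eq_Suc)
  have q': "(q' has_real_derivative q'' v) (at v)" for v
  proof -
    have "((\<lambda>v. 3 * max 0 v ^ 2) has_real_derivative 3 * (2 * max 0 v)) (at v)"
      using has_real_derivative_pos_part_power[of 0 v] by (intro DERIV_cmult) (simp add: numeral_eq_Suc)
    then show ?thesis by (simp add: q'_def[abs_def] q''_def)
  qed
  have \<beta>: "(\<beta> has_real_derivative - 2 * u) (at u)" for u
    unfolding \<beta>_def by (auto intro!: derivative_eq_intros)
  have cont: "continuous_on UNIV q" "continuous_on UNIV q'" "continuous_on UNIV q''" "continuous_on UNIV \<beta>"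
    unfolding q_def q'_def q''_def \<beta>_def by (intro continuous_intros)+
  define E where "E u = 1 - q (1 - q (\<beta> u))" for u
  define E' where "E' u = q' (1 - q (\<beta> u)) * (q' (\<beta> u) * (- 2 * u))" for u
  define E'' where "E'' u = q'' (1 - q (\<beta> u)) * - (q' (\<beta> u) * (- 2 * u)) * (q' (\<beta> u) * (- 2 * u))
     + q' (1 - q (\<beta> u)) * (q'' (\<beta> u) * (- 2 * u) * (- 2 * u) + q' (\<beta> u) * (- 2))" for u
  have q\<beta>: "((\<lambda>u. q (\<beta> u)) has_real_derivative q' (\<beta> u) * (- 2 * u)) (at u)" for u
    using DERIV_chain2[OF q \<beta>] .
  have q'\<beta>: "((\<lambda>u. q' (\<beta> u)) has_real_derivative q'' (\<beta> u) * (- 2 * u)) (at u)" for u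
    using DERIV_chain2[OF q' \<beta>] .
  have i: "((\<lambda>u. 1 - q (\<beta> u)) has_real_derivative - (q' (\<beta> u) * (- 2 * u))) (at u)" for u
    using DERIV_diff[OF DERIV_const q\<beta>, of 1 u] by simp
  have dE: "(E has_real_derivative E' u) (at u)" for u
    unfolding E_def[abs_def] E'_def using DERIV_diff[OF DERIV_const DERIV_chain2[OF q i], of 1 u] by simp
  have dE': "(E' has_real_derivative E'' u) (at u)" for u
  proof -
    have "((\<lambda>u. q' (\<beta> u) * (- 2 * u)) has_real_derivative q'' (\<beta> u) * (- 2 * u) * (- 2 * u) + (- 2) * q' (\<beta> u)) (at u)"
      by (rule DERIV_mult[OF q'\<beta>]) (auto intro!: derivative_eq_intros)
    from DERIV_mult[OF DERIV_chain2[OF q' i] this] show ?thesis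
      unfolding E'_def[abs_def] E''_def by (simp add: algebra_simps)
  qed
  have comp: "continuous_on UNIV (\<lambda>u. f (g u))"
    if "continuous_on UNIV f" "continuous_on UNIV g" for f g :: "real \<Rightarrow> real"
    using continuous_on_compose2[OF that] by simp
  have cont_E: "continuous_on UNIV E" "continuous_on UNIV E'" "continuous_on UNIV E''"
    unfolding E_def E'_def E''_def by (intro continuous_intros comp[OF cont(1)] comp[OF cont(2)] comp[OF cont(3)] cont(4))+
  define R where "R = L + 1"
  have zero: "E u = 0" "E' u = 0" "E'' u = 0" if "R < \<bar>u\<bar>" for u
  proof -
    have "L\<^sup>2 + 1 \<le> R\<^sup>2" using assms by (simp add: R_def power2_eq_square algebra_simps)
    also have "\<dots> \<le> \<bar>u\<bar>\<^sup>2" using that assms by (intro power_mono) (auto simp: R_def)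
    finally have "\<beta> u \<le> 0" by (simp add: \<beta>_def)
    then show "E u = 0" "E' u = 0" "E'' u = 0"
      by (simp_all add: E_def E'_def E''_def q_def q'_def q''_def)
  qed
  have bnd: "\<exists>B. \<forall>u. \<bar>f u\<bar> \<le> B" if f: "continuous_on UNIV f" and f0: "\<And>u. R < \<bar>u\<bar> \<Longrightarrow> f u = 0" for f :: "real \<Rightarrow> real"
  proof -
    have "bounded (f ` {-R..R})"
      by (intro compact_imp_bounded compact_continuous_image continuous_on_subset[OF f]) auto
    then obtain B where "\<forall>u\<in>{-R..R}. \<bar>f u\<bar> \<le> B"
      by (auto simp: bounded_iff)
    then have B: "\<bar>f u\<bar> \<le> B" if "u \<in> {-R..R}" for u
      using that by blast
    have "\<bar>f u\<bar> \<le> max B 0" for u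
    proof (cases "R < \<bar>u\<bar>")
      case False
      then have "u \<in> {-R..R}" by auto
      from B[OF this] show ?thesis by linarith
    qed (simp add: f0)
    then show ?thesis by blast
  qed
  obtain B0 B1 B2 where B: "\<And>u. \<bar>E u\<bar> \<le> B0" "\<And>u. \<bar>E' u\<bar> \<le> B1" "\<And>u. \<bar>E'' u\<bar> \<le> B2"
    using bnd[OF cont_E(1) zero(1)] bnd[OF cont_E(2) zero(2)] bnd[OF cont_E(3) zero(3)] by blast
  define C where "C = (B0 + B1 + B2) * exp R"
  have nonneg: "0 \<le> B0" "0 \<le> B1" "0 \<le> B2"
    using B[of 0] by linarith+
  have le: "\<bar>f u\<bar> \<le> C * exp (- (1 * \<bar>u\<bar>))"
    if "\<bar>f u\<bar> \<le> B0 + B1 + B2" "R < \<bar>u\<bar> \<Longrightarrow> f u = 0" for f :: "real \<Rightarrow> real" and u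
  proof (cases "R < \<bar>u\<bar>")
    case False
    have "(B0 + B1 + B2) * 1 \<le> (B0 + B1 + B2) * exp (R - \<bar>u\<bar>)"
      using False nonneg by (intro mult_left_mono) auto
    then show ?thesis
      using that(1) by (simp add: C_def exp_diff exp_minus divide_inverse)
  next
    case True
    then show ?thesis using that(2) nonneg by (simp add: C_def)
  qed
  have "\<bar>E u\<bar> \<le> B0 + B1 + B2" "\<bar>E' u\<bar> \<le> B0 + B1 + B2" "\<bar>E'' u\<bar> \<le> B0 + B1 + B2" for u
    using B[of u] nonneg by linarith+
  note sums_le = this
  show thesis
  proof
    show "C2_dominated (\<lambda>u. C * exp (- (1 * \<bar>u\<bar>))) E E' E''"
      unfolding C2_dominated_def by (intro conjI allI dE dE' cont_E le) (rule sums_le, simp add: zero)+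
    show "0 \<le> E u" for u
      unfolding E_def q_def by (simp add: power_le_one)
    show "E u = 1" if "\<bar>u\<bar> \<le> L" for u
    proof -
      have "u\<^sup>2 \<le> L\<^sup>2" using that by (simp add: abs_le_square_iff[symmetric])
      then have "1 \<le> max 0 (\<beta> u)" by (simp add: \<beta>_def)
      then have "1 \<le> q (\<beta> u)" unfolding q_def by (rule one_le_power)
      then show ?thesis unfolding E_def by (subst q_def) simp
    qed
  qed
qed

text \<open>
  The complement of the support is a union of open null sets; by Lindelof's theorem countably many suffice.
\<close>

lemma AE_in_measure_support:
  assumes sets: "sets \<rho> = sets borel"
  shows "AE u in \<rho>. u \<in> measure_support \<rho>"
proof -
  define \<U> where "\<U> = {U :: real set. open U \<and> emeasure \<rho> U = 0}"
  obtain \<V> where \<V>: "\<V> \<subseteq> \<U>" "countable \<V>" "\<Union>\<V> = \<Union>\<U>"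
    using Lindelof[of \<U>] by (auto simp: \<U>_def)
  have "(\<Union>U\<in>\<V>. U) \<in> null_sets \<rho>"
    using \<V>(1,2) sets by (intro null_sets_UN') (auto simp: \<U>_def null_sets_def)
  moreover have "- measure_support \<rho> \<subseteq> \<Union>\<U>"
    by (auto simp: measure_support_def \<U>_def zero_less_iff_neq_zero)
  ultimately show ?thesis
    using \<V>(3) by (intro AE_I'[of "\<Union>\<V>"]) auto
qed

lemma compact_support_bounded:
  assumes "sets \<rho> = sets borel" "compact (measure_support \<rho>)"
  obtains L where "0 \<le> L" "AE u in \<rho>. \<bar>u\<bar> \<le> L"
proof -
  obtain L where L: "\<And>u. u \<in> measure_support \<rho> \<Longrightarrow> \<bar>u\<bar> \<le> L"
    using compact_imp_bounded[OF assms(2)] by (auto simp: bounded_iff)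
  show thesis
  proof
    show "AE u in \<rho>. \<bar>u\<bar> \<le> max 0 L"
      using AE_in_measure_support[OF assms(1)] by eventually_elim (use L in force)
  qed simp
qed

lemma exp_moment_of_compact_support:
  assumes "real_distribution \<rho>" "compact (measure_support \<rho>)"
  shows "integrable \<rho> (\<lambda>u. exp (\<bar>u\<bar> * \<kappa>))"
proof -
  interpret real_distribution \<rho> by fact
  obtain L where L: "0 \<le> L" "AE u in \<rho>. \<bar>u\<bar> \<le> L"
    using compact_support_bounded[OF events_eq_borel assms(2)] .
  show ?thesis
  proof (rule integrable_const_bound[where B="exp (L * \<bar>\<kappa>\<bar>)"])
    show "AE u in \<rho>. norm (exp (\<bar>u\<bar> * \<kappa>)) \<le> exp (L * \<bar>\<kappa>\<bar>)"
      using L(2)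
    proof eventually_elim
      fix u assume "\<bar>u\<bar> \<le> L"
      have "\<bar>u\<bar> * \<kappa> \<le> \<bar>u\<bar> * \<bar>\<kappa>\<bar>" by (intro mult_left_mono) auto
      also have "\<dots> \<le> L * \<bar>\<kappa>\<bar>" using \<open>\<bar>u\<bar> \<le> L\<close> by (intro mult_right_mono) auto
      finally show "norm (exp (\<bar>u\<bar> * \<kappa>)) \<le> exp (L * \<bar>\<kappa>\<bar>)" by simp
    qed
  qed measurable
qed

lemma integral_uminus_symmetric:
  fixes f :: "real \<Rightarrow> 'b::{banach, second_countable_topology}"
  assumes "distr \<rho> borel uminus = \<rho>" "f \<in> borel_measurable borel" "sets \<rho> = sets borel"
  shows "(\<integral>u. f (- u) \<partial>\<rho>) = (\<integral>u. f u \<partial>\<rho>)"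
  using integral_distr[of uminus \<rho> borel f] assms by (simp add: measurable_cong_sets[OF assms(3) refl])

text \<open>
  Since \<open>E = 1\<close> on the support, \<open>\<rho>\<close> is \<open>\<rho>\<close> itself reweighted by the cutoff \<open>E\<close>, and the criterion applies
  with \<open>\<mu> = \<rho>\<close>. The values \<open>a = 1\<close> and \<open>\<kappa> = 2\<close> serve as well as any others with \<open>a < \<kappa>\<close>.
\<close>

lemma compact_support_case:
  assumes \<rho>: "spectral_measure r \<rho>" and supp: "compact (measure_support \<rho>)"
    and r: "integrable lborel (\<lambda>t. \<bar>r t\<bar>)"
  shows "assumption_A \<rho> \<and> has_bounded_continuous_density \<rho>"
proof -
  have dist: "real_distribution \<rho>" and sym: "distr \<rho> borel uminus = \<rho>"
    and ft: "complex_of_real (r t) = fourier_transform \<rho> t" for t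
    using \<rho> by (auto simp: spectral_measure_def)
  interpret real_distribution \<rho> by fact
  obtain L where L: "0 \<le> L" "AE u in \<rho>. \<bar>u\<bar> \<le> L"
    using compact_support_bounded[OF events_eq_borel supp] .
  obtain E E' E'' C where E: "C2_dominated (\<lambda>u. C * exp (- (1 * \<bar>u\<bar>))) E E' E''"
    and E_nonneg: "\<And>u. 0 \<le> E u" and E_1: "\<And>u. \<bar>u\<bar> \<le> L \<Longrightarrow> E u = 1"
    using C2_cutoff[OF L(1)] by metis
  have [measurable]: "E \<in> borel_measurable borel"
    by (intro borel_measurable_continuous_onI C2_dominated_continuous[OF E])
  have "\<rho> = density \<rho> (\<lambda>_. 1)" by (simp add: density_1)
  also have "\<dots> = density \<rho> (\<lambda>u. ennreal (E u))"
    using L(2) by (intro density_cong) (auto elim!: eventually_mono simp: E_1)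
  finally have \<rho>_eq: "\<rho> = density \<rho> (\<lambda>u. ennreal (E u))" .
  have char_eq: "char \<rho> t = r t" for t
    using integral_uminus_symmetric[OF sym _ events_eq_borel, of "\<lambda>u. iexp (t * u)"]
    unfolding ft fourier_transform_def char_def by (simp add: mult_ac)
  have "integrable lborel (char \<rho>)"
    by (rule Bochner_Integration.integrable_bound[OF r]) (auto simp: char_eq)
  then show ?thesis
    using exp_moment_of_compact_support[OF dist supp, of 2]
    by (intro assumption_A_and_density_criterion[OF dist _ \<rho>_eq E_nonneg E, of 2]) auto
qed

text \<open>
  Each derivative of \<open>1 / cosh (a * u)\<close> is \<open>1 / cosh (a * u)\<close> times a polynomial in the bounded quantity
  \<open>sinh (a * u) / cosh (a * u)\<close>.
\<close>

lemma C2_dominated_sech: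
  assumes "0 < a"
  shows "\<exists>E' E''. C2_dominated (\<lambda>u. 6 * (1 + a)\<^sup>2 * exp (- (a * \<bar>u\<bar>))) (\<lambda>u. 1 / cosh (a * u)) E' E''"
proof (intro exI)
  let ?E' = "\<lambda>u. - a * sinh (a * u) / cosh (a * u) ^ 2"
  let ?E'' = "\<lambda>u. a\<^sup>2 * (2 * (sinh (a * u) / cosh (a * u))\<^sup>2 - 1) / cosh (a * u)"
  have tanh: "\<bar>sinh x / cosh x\<bar> \<le> 1" for x :: real
  proof -
    have "\<bar>sinh x\<bar> \<le> cosh x"
      by (simp add: abs_le_iff sinh_def cosh_def field_simps)
    then show ?thesis by simp
  qed
  have nz: "cosh x \<noteq> 0" for x :: real
    using cosh_real_pos[of x] by linarith
  have sech: "1 / cosh (a * u) \<le> 2 * exp (- (a * \<bar>u\<bar>))" for u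
  proof -
    have "exp (a * \<bar>u\<bar>) \<le> 2 * cosh (a * u)"
      using assms by (cases "u \<ge> 0") (auto simp: cosh_def)
    then show ?thesis by (simp add: exp_minus field_simps)
  qed
  have bound: "\<bar>x * (1 / cosh (a * u))\<bar> \<le> 6 * (1 + a)\<^sup>2 * exp (- (a * \<bar>u\<bar>))" if "\<bar>x\<bar> \<le> 3 * (1 + a)\<^sup>2" for x u
  proof -
    have "\<bar>x * (1 / cosh (a * u))\<bar> = \<bar>x\<bar> * (1 / cosh (a * u))"
      by (simp add: abs_mult)
    also have "\<dots> \<le> 3 * (1 + a)\<^sup>2 * (2 * exp (- (a * \<bar>u\<bar>)))"
      using that sech by (intro mult_mono) auto
    finally show ?thesis by simp
  qed
  have a: "1 \<le> 3 * (1 + a)\<^sup>2" "a \<le> 3 * (1 + a)\<^sup>2" "3 * a\<^sup>2 \<le> 3 * (1 + a)\<^sup>2"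
    using assms by (auto simp: power2_eq_square algebra_simps intro!: add_nonneg_nonneg)
  have b0: "\<bar>1 / cosh (a * u)\<bar> \<le> 6 * (1 + a)\<^sup>2 * exp (- (a * \<bar>u\<bar>))" for u
    using bound[of 1 u] a by simp
  have b1: "\<bar>?E' u\<bar> \<le> 6 * (1 + a)\<^sup>2 * exp (- (a * \<bar>u\<bar>))" for u
  proof -
    have "\<bar>- a * (sinh (a * u) / cosh (a * u))\<bar> \<le> a * 1"
      using tanh[of "a * u"] assms by (simp only: abs_mult abs_minus_cancel) (intro mult_mono, auto)
    then show ?thesis
      using bound[of "- a * (sinh (a * u) / cosh (a * u))" u] a by (simp add: power2_eq_square)
  qed
  have b2: "\<bar>?E'' u\<bar> \<le> 6 * (1 + a)\<^sup>2 * exp (- (a * \<bar>u\<bar>))" for u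
  proof -
    have "(sinh (a * u) / cosh (a * u))\<^sup>2 \<le> 1"
      using tanh[of "a * u"] by (simp only: abs_square_le_1)
    then have "\<bar>2 * (sinh (a * u) / cosh (a * u))\<^sup>2 - 1\<bar> \<le> 3"
      using zero_le_power2[of "sinh (a * u) / cosh (a * u)"] by linarith
    then have "\<bar>a\<^sup>2 * (2 * (sinh (a * u) / cosh (a * u))\<^sup>2 - 1)\<bar> \<le> a\<^sup>2 * 3"
      unfolding abs_mult by (intro mult_mono) auto
    then show ?thesis
      using bound[of "a\<^sup>2 * (2 * (sinh (a * u) / cosh (a * u))\<^sup>2 - 1)" u] a by simp
  qed
  have d1: "((\<lambda>u. 1 / cosh (a * u)) has_real_derivative ?E' u) (at u)" for u
    using nz by (auto intro!: derivative_eq_intros simp: power2_eq_square)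
  have d2: "(?E' has_real_derivative ?E'' u) (at u)" for u
    using nz[of "a * u"]
    by (auto intro!: derivative_eq_intros) (simp add: field_simps power2_eq_square power4_eq_xxxx)
  have cont: "continuous_on UNIV ?E''"
    using nz by (intro continuous_intros) auto
  show "C2_dominated (\<lambda>u. 6 * (1 + a)\<^sup>2 * exp (- (a * \<bar>u\<bar>))) (\<lambda>u. 1 / cosh (a * u)) ?E' ?E''"
    unfolding C2_dominated_def by (intro conjI allI d1 d2 cont b0 b1 b2)
qed

text \<open>
  Reweighting \<open>\<rho>\<close> by \<open>cosh (2 * \<kappa>\<^sub>o * u)\<close> and normalising gives a probability measure \<open>\<mu>\<close> whose
  characteristic function is \<open>r_cosh \<rho> \<kappa>\<^sub>o\<close> up to a constant, because by symmetry the sine part integrates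
  to \<open>0\<close>. Conversely \<open>\<rho>\<close> has density \<open>m / cosh (2 * \<kappa>\<^sub>o * u)\<close> with respect to \<open>\<mu>\<close>.
\<close>

lemma exp_moment_case:
  assumes \<rho>: "spectral_measure r \<rho>" and exp_moment: "integrable \<rho> (\<lambda>u. exp (\<bar>u\<bar> * \<kappa>))"
    and \<kappa>\<^sub>o: "0 < \<kappa>\<^sub>o" "\<kappa>\<^sub>o < \<kappa> / 2" and r_cosh: "integrable lborel (\<lambda>t. \<bar>r_cosh \<rho> \<kappa>\<^sub>o t\<bar>)"
  shows "assumption_A \<rho> \<and> has_bounded_continuous_density \<rho>"
proof -
  have dist: "real_distribution \<rho>" and sym: "distr \<rho> borel uminus = \<rho>"
    using \<rho> by (auto simp: spectral_measure_def)
  interpret real_distribution \<rho> by fact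
  define a where "a = 2 * \<kappa>\<^sub>o"
  have a: "0 < a" "a < \<kappa>" using \<kappa>\<^sub>o by (auto simp: a_def)
  have [measurable]: "(\<lambda>u::real. cosh (a * u)) \<in> borel_measurable borel"
    by (intro borel_measurable_continuous_onI continuous_intros)
  have int_cosh: "integrable \<rho> (\<lambda>u. cosh (a * u))"
  proof (rule integrable_power_mult_exp[OF events_eq_borel exp_moment a(2), of _ 0])
    show "\<bar>cosh (a * u)\<bar> \<le> \<bar>u\<bar> ^ 0 * exp (a * \<bar>u\<bar>)" for u
      using cosh_le_exp_abs[of "a * u"] a by (simp add: abs_mult)
  qed measurable
  define m where "m = (\<integral>u. cosh (a * u) \<partial>\<rho>)"
  have "(\<integral>u. 1 \<partial>\<rho>) \<le> m"
    unfolding m_def by (intro integral_mono int_cosh) (auto simp: cosh_real_ge_1)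
  then have "0 < m" using prob_space by simp
  define \<mu> where "\<mu> = density \<rho> (\<lambda>u. ennreal (cosh (a * u) / m))"
  have "real_distribution \<mu>"
  proof (intro real_distribution.intro prob_spaceI real_distribution_axioms.intro)
    have "emeasure \<mu> (space \<mu>) = (\<integral>\<^sup>+u. ennreal (cosh (a * u) / m) \<partial>\<rho>)"
      unfolding \<mu>_def by (subst emeasure_density) auto
    also have "\<dots> = ennreal (\<integral>u. cosh (a * u) / m \<partial>\<rho>)"
      using \<open>0 < m\<close> int_cosh by (intro nn_integral_eq_integral) auto
    also have "(\<integral>u. cosh (a * u) / m \<partial>\<rho>) = 1"
      using \<open>0 < m\<close> by (simp add: m_def[symmetric])
    finally show "emeasure \<mu> (space \<mu>) = 1" by simp
  qed (simp_all add: \<mu>_def)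
  interpret \<mu>: real_distribution \<mu> by fact
  have char_eq: "char \<mu> t = complex_of_real (r_cosh \<rho> \<kappa>\<^sub>o t) / m" for t
  proof -
    have int: "integrable \<rho> (\<lambda>u. f (t * u) * cosh (a * u))" if "\<And>x. \<bar>f x\<bar> \<le> 1" "f \<in> borel_measurable borel" for f :: "real \<Rightarrow> real"
      using that(2) by (intro Bochner_Integration.integrable_bound[OF int_cosh])
        (auto simp: abs_mult that(1) intro!: mult_left_le_one_le)
    have "(\<integral>u. sin (t * (- u)) * cosh (a * (- u)) \<partial>\<rho>) = (\<integral>u. sin (t * u) * cosh (a * u) \<partial>\<rho>)"
      by (rule integral_uminus_symmetric[OF sym _ events_eq_borel]) measurable
    then have sin_0: "(\<integral>u. sin (t * u) * cosh (a * u) \<partial>\<rho>) = 0"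
      by simp
    have "char \<mu> t = (CLINT u|\<rho>. (cosh (a * u) / m) *\<^sub>R iexp (t * u))"
      unfolding char_def \<mu>_def using \<open>0 < m\<close> by (subst integral_density) auto
    also have "\<dots> = (CLINT u|\<rho>. (complex_of_real (cos (t * u) * cosh (a * u)) + \<i> * complex_of_real (sin (t * u) * cosh (a * u))) / m)"
      by (intro Bochner_Integration.integral_cong refl)
         (simp add: complex_eq_iff Re_exp Im_exp)
    also have "\<dots> = ((CLINT u|\<rho>. complex_of_real (cos (t * u) * cosh (a * u)))
         + \<i> * (CLINT u|\<rho>. complex_of_real (sin (t * u) * cosh (a * u)))) / m"
    proof -
      have "integrable \<rho> (\<lambda>u. complex_of_real (cos (t * u) * cosh (a * u)))"
        "integrable \<rho> (\<lambda>u. complex_of_real (sin (t * u) * cosh (a * u)))"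
        using int[of cos] int[of sin] by (simp_all only: complex_of_real_integrable_eq) auto
      then show ?thesis by (simp del: of_real_mult)
    qed
    also have "\<dots> = complex_of_real (r_cosh \<rho> \<kappa>\<^sub>o t) / m"
      unfolding integral_complex_of_real sin_0 by (simp add: r_cosh_def a_def)
    finally show ?thesis .
  qed
  have "integrable lborel (\<lambda>t. \<bar>r_cosh \<rho> \<kappa>\<^sub>o t\<bar> / m)"
    using r_cosh by simp
  then have int_char: "integrable lborel (char \<mu>)"
    by (rule Bochner_Integration.integrable_bound) (use \<open>0 < m\<close> in \<open>auto simp: char_eq norm_divide\<close>)
  have "\<rho> = density \<rho> (\<lambda>_. 1)" by (simp add: density_1)
  also have "\<dots> = density \<mu> (\<lambda>u. ennreal (m * (1 / cosh (a * u))))"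
  proof -
    have "cosh (a * u) \<noteq> 0" for u
      using cosh_real_pos[of "a * u"] by linarith
    then show ?thesis
      unfolding \<mu>_def using \<open>0 < m\<close>
      by (subst density_density_eq) (auto simp flip: ennreal_mult' intro!: density_cong)
  qed
  finally have \<rho>_eq: "\<rho> = density \<mu> (\<lambda>u. ennreal (m * (1 / cosh (a * u))))" .
  obtain E' E'' where E: "C2_dominated (\<lambda>u. 6 * (1 + a)\<^sup>2 * exp (- (a * \<bar>u\<bar>))) (\<lambda>u. 1 / cosh (a * u)) E' E''"
    using C2_dominated_sech[OF a(1)] by auto
  have "C2_dominated (\<lambda>_. m) (\<lambda>_. m) (\<lambda>_. 0) (\<lambda>_. 0)"
    using \<open>0 < m\<close> by (auto simp: C2_dominated_def)
  from C2_dominated_mult[OF this E] obtain E' E'' where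
    "C2_dominated (\<lambda>u. 24 * m * (1 + a)\<^sup>2 * exp (- (a * \<bar>u\<bar>))) (\<lambda>u. m * (1 / cosh (a * u))) E' E''"
    by (auto simp: mult_ac)
  from assumption_A_and_density_criterion[OF \<open>real_distribution \<mu>\<close> int_char \<rho>_eq _ this a exp_moment] \<open>0 < m\<close>
  show ?thesis by simp
qed

section \<open>Analytic sample paths\<close>

lemma AE_summable_of_L1_bounds:
  fixes Z :: "nat \<Rightarrow> 'a \<Rightarrow> real"
  assumes [measurable]: "\<And>k. Z k \<in> borel_measurable M"
    and le: "\<And>k. (\<integral>\<^sup>+\<omega>. ennreal \<bar>Z k \<omega>\<bar> \<partial>M) \<le> ennreal (b k)"
    and b: "\<And>k. 0 \<le> b k" "summable b"
  shows "AE \<omega> in M. summable (\<lambda>k. \<bar>Z k \<omega>\<bar>)"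
proof -
  have "(\<integral>\<^sup>+\<omega>. (\<Sum>k. ennreal \<bar>Z k \<omega>\<bar>) \<partial>M) = (\<Sum>k. \<integral>\<^sup>+\<omega>. ennreal \<bar>Z k \<omega>\<bar> \<partial>M)"
    by (intro nn_integral_suminf) auto
  also have "\<dots> \<le> (\<Sum>k. ennreal (b k))"
    by (intro suminf_le le) auto
  also have "\<dots> = ennreal (\<Sum>k. b k)"
    using b by (intro suminf_ennreal2)
  finally have "(\<integral>\<^sup>+\<omega>. (\<Sum>k. ennreal \<bar>Z k \<omega>\<bar>) \<partial>M) \<noteq> \<infinity>"
    by (auto simp: top_unique)
  then have "AE \<omega> in M. (\<Sum>k. ennreal \<bar>Z k \<omega>\<bar>) \<noteq> \<infinity>"
    by (intro nn_integral_PInf_AE) auto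
  then show ?thesis
    by eventually_elim (auto intro!: summable_suminf_not_top)
qed

text \<open>
  Summable \<open>L\<^sup>1\<close> increments give an almost surely absolutely convergent telescoping series. This constructs
  mean-square derivatives as almost sure limits along dyadic steps.
\<close>

lemma AE_convergent_of_L1_bounds:
  fixes Z :: "nat \<Rightarrow> 'a \<Rightarrow> real"
  assumes "\<And>k. Z k \<in> borel_measurable M"
    and "\<And>k. (\<integral>\<^sup>+\<omega>. ennreal \<bar>Z (Suc k) \<omega> - Z k \<omega>\<bar> \<partial>M) \<le> ennreal (b k)"
    and "\<And>k. 0 \<le> b k" "summable b"
  shows "AE \<omega> in M. convergent (\<lambda>k. Z k \<omega>)"
proof -
  have "AE \<omega> in M. summable (\<lambda>k. \<bar>Z (Suc k) \<omega> - Z k \<omega>\<bar>)"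
    using assms by (intro AE_summable_of_L1_bounds[where b=b]) auto
  then show ?thesis
  proof eventually_elim
    fix \<omega> assume "summable (\<lambda>k. \<bar>Z (Suc k) \<omega> - Z k \<omega>\<bar>)"
    then have "summable (\<lambda>k. Z (Suc k) \<omega> - Z k \<omega>)"
      by (rule summable_rabs_cancel)
    then have "convergent (\<lambda>n. \<Sum>k<n. Z (Suc k) \<omega> - Z k \<omega>)"
      by (simp add: summable_iff_convergent)
    then have "convergent (\<lambda>n. Z 0 \<omega> + (Z n \<omega> - Z 0 \<omega>))"
      unfolding sum_lessThan_telescope[of "\<lambda>k. Z k \<omega>"] by (intro convergent_add convergent_const)
    then show "convergent (\<lambda>k. Z k \<omega>)" by simp
  qed
qed

text \<open>
  Fatou's lemma, in the form in which an \<open>L\<^sup>1\<close> bound on approximations passes to an almost sure limit.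
\<close>

lemma nn_integral_abs_limit_le:
  fixes Z :: "nat \<Rightarrow> 'a \<Rightarrow> real"
  assumes [measurable]: "\<And>k. Z k \<in> borel_measurable M"
    and lim: "AE \<omega> in M. (\<lambda>k. Z k \<omega>) \<longlonglongrightarrow> W \<omega>"
    and le: "\<And>k. (\<integral>\<^sup>+\<omega>. ennreal \<bar>Z k \<omega>\<bar> \<partial>M) \<le> ennreal (b k)" and b: "b \<longlonglongrightarrow> \<beta>"
  shows "(\<integral>\<^sup>+\<omega>. ennreal \<bar>W \<omega>\<bar> \<partial>M) \<le> ennreal \<beta>"
proof -
  have "(\<integral>\<^sup>+\<omega>. ennreal \<bar>W \<omega>\<bar> \<partial>M) = (\<integral>\<^sup>+\<omega>. liminf (\<lambda>k. ennreal \<bar>Z k \<omega>\<bar>) \<partial>M)"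
  proof (rule nn_integral_cong_AE)
    show "AE \<omega> in M. ennreal \<bar>W \<omega>\<bar> = liminf (\<lambda>k. ennreal \<bar>Z k \<omega>\<bar>)"
      using lim
    proof eventually_elim
      fix \<omega> assume "(\<lambda>k. Z k \<omega>) \<longlonglongrightarrow> W \<omega>"
      then have "(\<lambda>k. ennreal \<bar>Z k \<omega>\<bar>) \<longlonglongrightarrow> ennreal \<bar>W \<omega>\<bar>"
        by (intro tendsto_ennrealI tendsto_rabs)
      then show "ennreal \<bar>W \<omega>\<bar> = liminf (\<lambda>k. ennreal \<bar>Z k \<omega>\<bar>)"
        by (rule lim_imp_Liminf[OF sequentially_bot, symmetric])
    qed
  qed
  also have "\<dots> \<le> liminf (\<lambda>k. \<integral>\<^sup>+\<omega>. ennreal \<bar>Z k \<omega>\<bar> \<partial>M)"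
    by (rule nn_integral_liminf) simp
  also have "\<dots> \<le> liminf (\<lambda>k. ennreal (b k))"
    by (intro Liminf_mono always_eventually allI le)
  also have "\<dots> = ennreal \<beta>"
    using b by (intro lim_imp_Liminf tendsto_ennrealI) auto
  finally show ?thesis .
qed

text \<open>
  The second order structure of the process in the spectral form: \<open>X t\<close> corresponds isometrically to the
  function \<open>u \<mapsto> iexp (u * t)\<close> in \<open>L\<^sup>2(\<rho>)\<close>.
\<close>

locale spectral_process = prob_space M for M :: "'a measure" +
  fixes X :: "real \<Rightarrow> 'a \<Rightarrow> real" and \<rho> :: "real measure"
  assumes X_measurable [measurable]: "X t \<in> borel_measurable M"
    and X_square: "integrable M (\<lambda>\<omega>. (X t \<omega>)\<^sup>2)"
    and \<rho>_distribution: "real_distribution \<rho>"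
    and X_covariance: "complex_of_real (\<integral>\<omega>. X t \<omega> * X s \<omega> \<partial>M) = (CLINT u|\<rho>. iexp (u * (t - s)))"
begin

sublocale \<rho>: real_distribution \<rho>
  by (rule \<rho>_distribution)

text \<open>
  A finite linear combination of the \<open>X t\<close> paired with the same combination of the functions
  \<open>u \<mapsto> iexp (u * t)\<close>, its symbol. Keeping the two together lets statements about random variables be computed
  as integrals of symbols.
\<close>

inductive spectral_rep :: "('a \<Rightarrow> real) \<Rightarrow> (real \<Rightarrow> complex) \<Rightarrow> bool" where
  base: "spectral_rep (X t) (\<lambda>u. iexp (u * t))"
| add: "spectral_rep Z g \<Longrightarrow> spectral_rep W h \<Longrightarrow> spectral_rep (\<lambda>\<omega>. Z \<omega> + W \<omega>) (\<lambda>u. g u + h u)"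
| scale: "spectral_rep Z g \<Longrightarrow> spectral_rep (\<lambda>\<omega>. c * Z \<omega>) (\<lambda>u. complex_of_real c * g u)"

lemma integrable_mult_of_squares:
  fixes Z W :: "'a \<Rightarrow> real"
  assumes [measurable]: "Z \<in> borel_measurable M" "W \<in> borel_measurable M"
    and "integrable M (\<lambda>\<omega>. (Z \<omega>)\<^sup>2)" "integrable M (\<lambda>\<omega>. (W \<omega>)\<^sup>2)"
  shows "integrable M (\<lambda>\<omega>. Z \<omega> * W \<omega>)"
proof (rule Bochner_Integration.integrable_bound)
  show "integrable M (\<lambda>\<omega>. (Z \<omega>)\<^sup>2 + (W \<omega>)\<^sup>2)"
    using assms by simp
  have "\<bar>x * y\<bar> \<le> x\<^sup>2 + y\<^sup>2" for x y :: real
  proof -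
    have "2 * (\<bar>x\<bar> * \<bar>y\<bar>) \<le> x\<^sup>2 + y\<^sup>2"
      using sum_squares_bound[of "\<bar>x\<bar>" "\<bar>y\<bar>"] by simp
    moreover have "0 \<le> \<bar>x\<bar> * \<bar>y\<bar>" by simp
    ultimately show ?thesis unfolding abs_mult by linarith
  qed
  then show "AE \<omega> in M. norm (Z \<omega> * W \<omega>) \<le> norm ((Z \<omega>)\<^sup>2 + (W \<omega>)\<^sup>2)"
    by (auto intro: order_trans[OF _ abs_ge_self])
qed simp

lemma spectral_rep_measurable:
  assumes "spectral_rep Z g"
  shows "Z \<in> borel_measurable M" "g \<in> borel_measurable borel"
  using assms
proof induction
  case (base t)
  {
    case 1 show ?case by measurable
  next
    case 2 show ?case by measurable
  }
next
  case (add Z g W h)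
  {
    case 1 show ?case using add by (intro borel_measurable_add)
  next
    case 2 show ?case using add by (intro borel_measurable_add)
  }
next
  case (scale Z g c)
  {
    case 1 show ?case using scale by (intro borel_measurable_times borel_measurable_const)
  next
    case 2 show ?case using scale by (intro borel_measurable_times borel_measurable_const)
  }
qed

lemma spectral_rep_bounded:
  assumes "spectral_rep Z g"
  shows "\<exists>B. \<forall>u. cmod (g u) \<le> B"
  using assms
proof induction
  case (base t)
  show ?case by (intro exI[of _ 1]) simp
next
  case (add Z g W h)
  then obtain B B' where "\<And>u. cmod (g u) \<le> B" "\<And>u. cmod (h u) \<le> B'" by blast
  then show ?case
    by (intro exI[of _ "B + B'"] allI) (meson add_mono norm_triangle_le)
next
  case (scale Z g c)
  then obtain B where "\<And>u. cmod (g u) \<le> B" by blast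
  then show ?case
    by (intro exI[of _ "\<bar>c\<bar> * B"]) (auto simp: norm_mult mult_left_mono)
qed

lemma spectral_rep_square:
  assumes "spectral_rep Z g"
  shows "integrable M (\<lambda>\<omega>. (Z \<omega>)\<^sup>2)"
  using assms
proof induction
  case (add Z g W h)
  then show ?case
    using integrable_mult_of_squares[of Z W] spectral_rep_measurable
    by (simp add: power2_sum mult.assoc)
qed (simp_all add: X_square power_mult_distrib)

lemma spectral_rep_integrable:
  assumes "spectral_rep Z g" "spectral_rep W h"
  shows "integrable M (\<lambda>\<omega>. Z \<omega> * W \<omega>)" "integrable \<rho> (\<lambda>u. g u * cnj (h u))"
proof -
  note [measurable, simp] = spectral_rep_measurable[OF assms(1)] spectral_rep_measurable[OF assms(2)]
  show "integrable M (\<lambda>\<omega>. Z \<omega> * W \<omega>)"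
    using assms by (intro integrable_mult_of_squares spectral_rep_square) auto
  obtain B B' where "\<And>u. cmod (g u) \<le> B" "\<And>u. cmod (h u) \<le> B'"
    using assms[THEN spectral_rep_bounded] by blast
  moreover have [measurable]: "(\<lambda>u. cnj (h u)) \<in> borel_measurable borel"
    by (intro borel_measurable_continuous_on[OF linear_continuous_on[OF bounded_linear_cnj]]) simp
  ultimately show "integrable \<rho> (\<lambda>u. g u * cnj (h u))"
    by (intro \<rho>.integrable_const_bound[where B="B * B'"]) (auto simp: norm_mult intro!: mult_mono' AE_I2)
qed

lemma spectral_rep_isometry:
  assumes Z: "spectral_rep Z g" and W: "spectral_rep W h"
  shows "complex_of_real (\<integral>\<omega>. Z \<omega> * W \<omega> \<partial>M) = (CLINT u|\<rho>. g u * cnj (h u))"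
  using Z
proof induction
  case (base t)
  show ?case
    using W
  proof induction
    case (base s)
    show ?case
      unfolding X_covariance by (simp add: exp_cnj right_diff_distrib flip: exp_add)
  next
    case (add W h W' h')
    then show ?case
      using spectral_rep_integrable[OF spectral_rep.base[of t] add.hyps(1)]
        spectral_rep_integrable[OF spectral_rep.base[of t] add.hyps(2)]
      by (simp add: distrib_left)
  next
    case (scale W h c)
    then show ?case
      by (simp add: mult.left_commute[of _ "complex_of_real c"] mult.left_commute[of _ c])
  qed
next
  case (add Z g Z' g')
  then show ?case
    using spectral_rep_integrable[OF add.hyps(1) W] spectral_rep_integrable[OF add.hyps(2) W]
    by (simp add: distrib_right)
next
  case (scale Z g c)
  then show ?case by (simp add: mult.assoc)
qed

text \<open>
  The isometry turns the second moment of \<open>Z\<close> into the integral of the squared symbol; nonnegativity of a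
  variance bounds the first absolute moment by it.
\<close>

lemma spectral_rep_L1_le:
  assumes "spectral_rep Z g"
  shows "(\<integral>\<^sup>+\<omega>. ennreal \<bar>Z \<omega>\<bar> \<partial>M) \<le> ennreal (sqrt (LINT u|\<rho>. (cmod (g u))\<^sup>2))"
proof -
  note [measurable] = spectral_rep_measurable[OF assms]
  have sq: "integrable M (\<lambda>\<omega>. (Z \<omega>)\<^sup>2)"
    by (rule spectral_rep_square[OF assms])
  have int: "integrable M (\<lambda>\<omega>. \<bar>Z \<omega>\<bar>)"
    using square_integrable_imp_integrable[OF _ sq] by simp
  have "complex_of_real (\<integral>\<omega>. (Z \<omega>)\<^sup>2 \<partial>M) = (CLINT u|\<rho>. complex_of_real ((cmod (g u))\<^sup>2))"
    using spectral_rep_isometry[OF assms assms] by (simp add: power2_eq_square[of "Z _"] flip: complex_norm_square)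
  then have eq: "(\<integral>\<omega>. (Z \<omega>)\<^sup>2 \<partial>M) = (LINT u|\<rho>. (cmod (g u))\<^sup>2)"
    unfolding integral_complex_of_real of_real_eq_iff .
  have "0 \<le> variance (\<lambda>\<omega>. \<bar>Z \<omega>\<bar>)"
    by (rule variance_positive)
  also have "\<dots> = expectation (\<lambda>\<omega>. \<bar>Z \<omega>\<bar>\<^sup>2) - (expectation (\<lambda>\<omega>. \<bar>Z \<omega>\<bar>))\<^sup>2"
    using int sq by (intro variance_eq) auto
  finally have "(expectation (\<lambda>\<omega>. \<bar>Z \<omega>\<bar>))\<^sup>2 \<le> (LINT u|\<rho>. (cmod (g u))\<^sup>2)"
    by (simp add: eq)
  then have "expectation (\<lambda>\<omega>. \<bar>Z \<omega>\<bar>) \<le> sqrt (LINT u|\<rho>. (cmod (g u))\<^sup>2)"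
    by (rule real_le_rsqrt)
  then show ?thesis
    using int by (subst nn_integral_eq_integral) (auto intro: ennreal_leI)
qed

text \<open>
  Difference quotients act on processes; on symbols they act as multiplication by \<open>quotient_symbol h\<close>, an
  approximation of \<open>\<i> * u\<close>. Iterates therefore have powers of \<open>quotient_symbol h\<close> as symbols.
\<close>

definition increment_quotient :: "real \<Rightarrow> (real \<Rightarrow> 'a \<Rightarrow> real) \<Rightarrow> real \<Rightarrow> 'a \<Rightarrow> real" where
  "increment_quotient h Z t \<omega> = (Z (t + h) \<omega> - Z t \<omega>) / h"

definition quotient_symbol :: "real \<Rightarrow> real \<Rightarrow> complex" where
  "quotient_symbol h u = (iexp (u * h) - 1) / h"

lemma spectral_rep_increment_quotient:
  "spectral_rep ((increment_quotient h ^^ n) X t) (\<lambda>u. quotient_symbol h u ^ n * iexp (u * t))"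
proof (induction n arbitrary: t)
  case 0
  show ?case using spectral_rep.base by simp
next
  case (Suc n)
  have "spectral_rep (\<lambda>\<omega>. (1 / h) * (increment_quotient h ^^ n) X (t + h) \<omega> + (- 1 / h) * (increment_quotient h ^^ n) X t \<omega>)
    (\<lambda>u. complex_of_real (1 / h) * (quotient_symbol h u ^ n * iexp (u * (t + h)))
       + complex_of_real (- 1 / h) * (quotient_symbol h u ^ n * iexp (u * t)))"
    by (intro spectral_rep.add spectral_rep.scale Suc.IH)
  moreover have "(\<lambda>\<omega>. (1 / h) * (increment_quotient h ^^ n) X (t + h) \<omega> + (- 1 / h) * (increment_quotient h ^^ n) X t \<omega>)
     = (increment_quotient h ^^ Suc n) X t"
    by (simp add: increment_quotient_def fun_eq_iff diff_divide_distrib)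
  moreover have "(\<lambda>u. complex_of_real (1 / h) * (quotient_symbol h u ^ n * iexp (u * (t + h)))
       + complex_of_real (- 1 / h) * (quotient_symbol h u ^ n * iexp (u * t)))
     = (\<lambda>u. quotient_symbol h u ^ Suc n * iexp (u * t))"
  proof
    fix u
    have "iexp (u * (t + h)) = iexp (u * t) * iexp (u * h)"
      by (simp add: distrib_left flip: exp_add)
    then show "complex_of_real (1 / h) * (quotient_symbol h u ^ n * iexp (u * (t + h)))
       + complex_of_real (- 1 / h) * (quotient_symbol h u ^ n * iexp (u * t))
       = quotient_symbol h u ^ Suc n * iexp (u * t)"
      by (simp add: quotient_symbol_def[of h u] power_Suc divide_inverse algebra_simps)
  qed
  ultimately show ?case by simp
qed

lemma norm_quotient_symbol_le: "cmod (quotient_symbol h u) \<le> \<bar>u\<bar>"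
proof -
  have "cmod (iexp (u * h) - 1) \<le> \<bar>u * h\<bar>"
    using iexp_approx1[of "u * h" 0] by simp
  then show ?thesis
    by (cases "h = 0") (simp_all add: quotient_symbol_def norm_divide divide_le_eq abs_mult)
qed

lemma norm_quotient_symbol_diff_le:
  assumes "h \<noteq> 0"
  shows "cmod (quotient_symbol h u - \<i> * u) \<le> \<bar>h\<bar> * u\<^sup>2 / 2"
proof -
  have "quotient_symbol h u - \<i> * u = (iexp (u * h) - (\<Sum>k\<le>1. (\<i> * complex_of_real (u * h)) ^ k / fact k)) / h"
    using assms by (simp add: quotient_symbol_def field_simps)
  also have "cmod \<dots> \<le> (\<bar>u * h\<bar> ^ Suc 1 / fact (Suc 1)) / \<bar>h\<bar>"
    unfolding norm_divide norm_of_real by (intro divide_right_mono iexp_approx1) auto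
  also have "\<dots> = \<bar>h\<bar> * u\<^sup>2 / 2"
    using assms by (simp add: abs_mult power2_eq_square field_simps)
  finally show ?thesis .
qed

lemma norm_power_diff_le:
  fixes z w :: complex
  assumes "cmod z \<le> B" "cmod w \<le> B" "cmod (z - w) \<le> c * B"
  shows "cmod (z ^ n - w ^ n) \<le> n * c * B ^ n"
proof (induction n)
  case (Suc n)
  have "0 \<le> B" "0 \<le> c * B" using assms(1,3) norm_ge_zero order_trans by blast+
  have "z ^ Suc n - w ^ Suc n = z * (z ^ n - w ^ n) + (z - w) * w ^ n"
    by (simp add: algebra_simps)
  also have "cmod \<dots> \<le> cmod z * cmod (z ^ n - w ^ n) + cmod (z - w) * cmod w ^ n"
    by (metis norm_mult norm_power norm_triangle_ineq)
  also have "\<dots> \<le> B * (n * c * B ^ n) + (c * B) * B ^ n"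
    using assms Suc.IH \<open>0 \<le> B\<close> \<open>0 \<le> c * B\<close> by (intro add_mono mult_mono power_mono) auto
  finally show ?case by (simp add: algebra_simps)
qed simp

definition dyadic_step :: "nat \<Rightarrow> real" where "dyadic_step k = (1 / 2) ^ k"

definition derivative_approx :: "nat \<Rightarrow> real \<Rightarrow> nat \<Rightarrow> 'a \<Rightarrow> real" where
  "derivative_approx n t k = (increment_quotient (dyadic_step k) ^^ n) X t"

lemma dyadic_step_pos: "0 < dyadic_step k" by (simp add: dyadic_step_def)

lemma spectral_rep_derivative_approx:
  "spectral_rep (derivative_approx n t k) (\<lambda>u. quotient_symbol (dyadic_step k) u ^ n * iexp (u * t))"
  unfolding derivative_approx_def by (rule spectral_rep_increment_quotient)

lemma measurable_derivative_approx [measurable]: "derivative_approx n t k \<in> borel_measurable M"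
  using spectral_rep_measurable(1)[OF spectral_rep_derivative_approx] .

context
  fixes \<kappa> :: real
  assumes \<kappa>: "0 < \<kappa>" and exp_moment: "integrable \<rho> (\<lambda>u. exp (\<bar>u\<bar> * \<kappa>))"
begin

lemma integrable_abs_power: "integrable \<rho> (\<lambda>u. \<bar>u\<bar> ^ n)"
  using \<kappa> by (intro integrable_power_mult_exp[OF \<rho>.events_eq_borel exp_moment, of 0 _ n]) auto

text \<open>
  Consecutive \<open>n\<close>-th difference quotients have symbols that differ by at most \<open>n * dyadic_step k * \<bar>u\<bar> ^ (n + 1)\<close>.
  All moments of \<open>\<rho>\<close> are finite, so the \<open>L\<^sup>1\<close> distances decay geometrically in \<open>k\<close>.
\<close>

lemma AE_convergent_derivative_approx: "AE \<omega> in M. convergent (\<lambda>k. derivative_approx n t k \<omega>)"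
proof -
  define c where "c = n * sqrt (LINT u|\<rho>. \<bar>u\<bar> ^ (2 * n + 2))"
  show ?thesis
  proof (rule AE_convergent_of_L1_bounds[where b="\<lambda>k. c * (1 / 2) ^ k"])
    fix k
    let ?d = "\<lambda>k. quotient_symbol (dyadic_step k)"
    have "spectral_rep (\<lambda>\<omega>. derivative_approx n t (Suc k) \<omega> + (- 1) * derivative_approx n t k \<omega>)
      (\<lambda>u. ?d (Suc k) u ^ n * iexp (u * t) + complex_of_real (- 1) * (?d k u ^ n * iexp (u * t)))"
      by (intro spectral_rep.add spectral_rep.scale spectral_rep_derivative_approx)
    moreover have "(\<lambda>u. ?d (Suc k) u ^ n * iexp (u * t) + complex_of_real (- 1) * (?d k u ^ n * iexp (u * t)))
       = (\<lambda>u. (?d (Suc k) u ^ n - ?d k u ^ n) * iexp (u * t))"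
      by (simp add: algebra_simps)
    ultimately have rep: "spectral_rep (\<lambda>\<omega>. derivative_approx n t (Suc k) \<omega> - derivative_approx n t k \<omega>)
       (\<lambda>u. (?d (Suc k) u ^ n - ?d k u ^ n) * iexp (u * t))"
      by simp
    have diff_le: "cmod (?d (Suc k) u ^ n - ?d k u ^ n) \<le> n * (dyadic_step k * \<bar>u\<bar>) * \<bar>u\<bar> ^ n" for u
    proof (rule norm_power_diff_le)
      have "cmod (?d (Suc k) u - ?d k u) \<le> cmod (?d (Suc k) u - \<i> * u) + cmod (?d k u - \<i> * u)"
        using norm_triangle_ineq4[of "?d (Suc k) u - \<i> * u" "?d k u - \<i> * u"] by simp
      also have "\<dots> \<le> \<bar>dyadic_step (Suc k)\<bar> * u\<^sup>2 / 2 + \<bar>dyadic_step k\<bar> * u\<^sup>2 / 2"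
        using dyadic_step_pos by (intro add_mono norm_quotient_symbol_diff_le) (auto simp: less_imp_neq[symmetric])
      also have "\<dots> \<le> dyadic_step k * u\<^sup>2"
        by (simp add: dyadic_step_def field_simps)
      finally show "cmod (?d (Suc k) u - ?d k u) \<le> dyadic_step k * \<bar>u\<bar> * \<bar>u\<bar>"
        by (simp add: power2_eq_square mult.assoc)
    qed (rule norm_quotient_symbol_le)+
    have "(LINT u|\<rho>. (cmod ((?d (Suc k) u ^ n - ?d k u ^ n) * iexp (u * t)))\<^sup>2)
        \<le> (LINT u|\<rho>. (n * dyadic_step k)\<^sup>2 * \<bar>u\<bar> ^ (2 * n + 2))"
    proof (rule Bochner_Integration.integral_mono')
      show "integrable \<rho> (\<lambda>u. (n * dyadic_step k)\<^sup>2 * \<bar>u\<bar> ^ (2 * n + 2))"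
        by (intro integrable_mult_right integrable_abs_power)
      fix u
      have "(cmod ((?d (Suc k) u ^ n - ?d k u ^ n) * iexp (u * t)))\<^sup>2 \<le> (n * (dyadic_step k * \<bar>u\<bar>) * \<bar>u\<bar> ^ n)\<^sup>2"
        unfolding norm_mult norm_exp_i_times mult_1_right by (intro power_mono diff_le) auto
      also have "\<dots> = (n * dyadic_step k)\<^sup>2 * \<bar>u\<bar> ^ (2 * n + 2)"
      proof -
        have "n * (dyadic_step k * \<bar>u\<bar>) * \<bar>u\<bar> ^ n = (n * dyadic_step k) * \<bar>u\<bar> ^ (n + 1)"
          by simp
        then show ?thesis
          by (simp only: power_mult_distrib[of "n * dyadic_step k"] power_mult[symmetric]) (simp add: mult.commute)
      qed
      finally show "(cmod ((?d (Suc k) u ^ n - ?d k u ^ n) * iexp (u * t)))\<^sup>2 \<le> (n * dyadic_step k)\<^sup>2 * \<bar>u\<bar> ^ (2 * n + 2)" .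
    qed auto
    then have "sqrt (LINT u|\<rho>. (cmod ((?d (Suc k) u ^ n - ?d k u ^ n) * iexp (u * t)))\<^sup>2)
        \<le> sqrt ((n * dyadic_step k)\<^sup>2 * (LINT u|\<rho>. \<bar>u\<bar> ^ (2 * n + 2)))"
      by simp
    also have "\<dots> = c * (1 / 2) ^ k"
      using dyadic_step_pos[of k] by (simp add: real_sqrt_mult c_def dyadic_step_def)
    finally have "ennreal (sqrt (LINT u|\<rho>. (cmod ((?d (Suc k) u ^ n - ?d k u ^ n) * iexp (u * t)))\<^sup>2))
        \<le> ennreal (c * (1 / 2) ^ k)"
      by (rule ennreal_leI)
    with spectral_rep_L1_le[OF rep]
    show "(\<integral>\<^sup>+\<omega>. ennreal \<bar>derivative_approx n t (Suc k) \<omega> - derivative_approx n t k \<omega>\<bar> \<partial>M) \<le> ennreal (c * (1 / 2) ^ k)"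
      by (rule order_trans)
    show "0 \<le> c * (1 / 2) ^ k"
      by (auto simp: c_def intro!: mult_nonneg_nonneg Bochner_Integration.integral_nonneg)
  qed (auto intro!: summable_mult)
qed

definition taylor_coeff :: "real \<Rightarrow> 'a \<Rightarrow> nat \<Rightarrow> real" where
  "taylor_coeff t \<omega> n = lim (\<lambda>k. derivative_approx n t k \<omega>) / fact n"

lemma measurable_taylor_coeff [measurable]: "(\<lambda>\<omega>. taylor_coeff t \<omega> n) \<in> borel_measurable M"
  unfolding taylor_coeff_def by measurable

lemma spectral_rep_taylor_approx:
  "spectral_rep (\<lambda>\<omega>. X (t + s) \<omega> - (\<Sum>n\<le>N. derivative_approx n t k \<omega> / fact n * s ^ n))
    (\<lambda>u. (iexp (u * s) - (\<Sum>n\<le>N. (s * quotient_symbol (dyadic_step k) u) ^ n / fact n)) * iexp (u * t))"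
proof -
  have sum: "spectral_rep (\<lambda>\<omega>. X (t + s) \<omega> + (\<Sum>n<N. (- (s ^ n) / fact n) * derivative_approx n t k \<omega>))
    (\<lambda>u. iexp (u * (t + s)) + (\<Sum>n<N. complex_of_real (- (s ^ n) / fact n) * (quotient_symbol (dyadic_step k) u ^ n * iexp (u * t))))" for N
  proof (induction N)
    case 0
    show ?case using spectral_rep.base[of "t + s"] by simp
  next
    case (Suc N)
    from spectral_rep.add[OF this spectral_rep.scale[OF spectral_rep_derivative_approx[where n=N and t=t and k=k], of "- (s ^ N) / fact N"]]
    show ?case by (simp only: sum.lessThan_Suc add.assoc)
  qed
  have 1: "(\<lambda>\<omega>. X (t + s) \<omega> + (\<Sum>n<Suc N. (- (s ^ n) / fact n) * derivative_approx n t k \<omega>))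
      = (\<lambda>\<omega>. X (t + s) \<omega> - (\<Sum>n\<le>N. derivative_approx n t k \<omega> / fact n * s ^ n))"
    unfolding lessThan_Suc_atMost diff_conv_add_uminus sum_negf[symmetric] by (simp add: mult_ac)
  have 2: "(\<lambda>u. iexp (u * (t + s)) + (\<Sum>n<Suc N. complex_of_real (- (s ^ n) / fact n) * (quotient_symbol (dyadic_step k) u ^ n * iexp (u * t))))
      = (\<lambda>u. (iexp (u * s) - (\<Sum>n\<le>N. (s * quotient_symbol (dyadic_step k) u) ^ n / fact n)) * iexp (u * t))"
  proof
    fix u
    have "iexp (u * (t + s)) = iexp (u * s) * iexp (u * t)"
      by (simp add: distrib_left add.commute flip: exp_add)
    then show "iexp (u * (t + s)) + (\<Sum>n<Suc N. complex_of_real (- (s ^ n) / fact n) * (quotient_symbol (dyadic_step k) u ^ n * iexp (u * t)))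
      = (iexp (u * s) - (\<Sum>n\<le>N. (s * quotient_symbol (dyadic_step k) u) ^ n / fact n)) * iexp (u * t)"
      unfolding lessThan_Suc_atMost diff_conv_add_uminus sum_negf[symmetric] distrib_right sum_distrib_right
      by (simp add: power_mult_distrib mult_ac)
  qed
  show ?thesis using sum[of "Suc N"] unfolding 1 2 .
qed

lemma norm_partial_exp_le: "cmod (\<Sum>n\<le>N. z ^ n / fact n) \<le> exp (cmod z)"
proof -
  have "cmod (\<Sum>n\<le>N. z ^ n / fact n) \<le> (\<Sum>n\<le>N. cmod z ^ n /\<^sub>R fact n)"
    by (rule order_trans[OF norm_sum]) (simp add: norm_mult norm_inverse norm_power divide_inverse mult.commute)
  also have "\<dots> \<le> exp (cmod z)"
    unfolding exp_def by (intro sum_le_suminf summable_exp_generic) auto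
  finally show ?thesis .
qed

text \<open>
  Before the limit \<open>k \<rightarrow> \<infinity>\<close> the remainder has the symbol
  \<open>iexp (u * s) - (\<Sum>n\<le>N. (s * quotient_symbol (dyadic_step k) u) ^ n / fact n)\<close>; in the limit this is the Taylor
  remainder of the exponential at \<open>\<i> * u * s\<close>, at most \<open>\<bar>u * s\<bar> ^ (N + 1) / fact (N + 1)\<close>. For \<open>\<bar>s\<bar> \<le> \<kappa> / 4\<close>
  the latter is at most \<open>(1 / 2) ^ (N + 1)\<close> times a term of the series of \<open>exp (\<bar>u\<bar> * \<kappa> / 2)\<close>, whose square is
  integrable by the exponential moment.
\<close>

lemma taylor_remainder_L1_le:
  assumes s: "\<bar>s\<bar> \<le> \<kappa> / 4"
  shows "(\<integral>\<^sup>+\<omega>. ennreal \<bar>X (t + s) \<omega> - (\<Sum>n\<le>N. taylor_coeff t \<omega> n * s ^ n)\<bar> \<partial>M)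
    \<le> ennreal (sqrt (LINT u|\<rho>. exp (\<bar>u\<bar> * \<kappa>)) * (1 / 2) ^ N)"
proof -
  define R where "R k u = iexp (u * s) - (\<Sum>n\<le>N. (s * quotient_symbol (dyadic_step k) u) ^ n / fact n)" for k u
  define R' where "R' u = iexp (u * s) - (\<Sum>n\<le>N. (\<i> * complex_of_real (u * s)) ^ n / fact n)" for u
  have [measurable]: "R k \<in> borel_measurable borel" "R' \<in> borel_measurable borel" for k
    unfolding R_def R'_def quotient_symbol_def by measurable
  have lim: "(\<lambda>k. LINT u|\<rho>. (cmod (R k u))\<^sup>2) \<longlonglongrightarrow> (LINT u|\<rho>. (cmod (R' u))\<^sup>2)"
  proof (rule integral_dominated_convergence[where w="\<lambda>u. 4 * exp (\<bar>u\<bar> * \<kappa>)"])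
    show "AE u in \<rho>. (\<lambda>k. (cmod (R k u))\<^sup>2) \<longlonglongrightarrow> (cmod (R' u))\<^sup>2"
    proof (intro AE_I2)
      fix u
      have "(\<lambda>k. quotient_symbol (dyadic_step k) u - \<i> * u) \<longlonglongrightarrow> 0"
      proof (rule Lim_null_comparison[OF always_eventually[OF allI]])
        show "norm (quotient_symbol (dyadic_step k) u - \<i> * u) \<le> \<bar>dyadic_step k\<bar> * u\<^sup>2 / 2" for k
          using dyadic_step_pos[of k] by (intro norm_quotient_symbol_diff_le) auto
        have "(\<lambda>k. (1 / 2) ^ k * (u\<^sup>2 / 2)) \<longlonglongrightarrow> 0 * (u\<^sup>2 / 2)"
          by (intro tendsto_mult_right LIMSEQ_power_zero) auto
        then show "(\<lambda>k. \<bar>dyadic_step k\<bar> * u\<^sup>2 / 2) \<longlonglongrightarrow> 0"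
          by (simp add: dyadic_step_def)
      qed
      then have "(\<lambda>k. quotient_symbol (dyadic_step k) u) \<longlonglongrightarrow> \<i> * u"
        by (rule LIM_zero_cancel)
      then have "(\<lambda>k. (cmod (R k u))\<^sup>2) \<longlonglongrightarrow>
          (cmod (iexp (u * s) - (\<Sum>n\<le>N. (s * (\<i> * u)) ^ n / fact n)))\<^sup>2"
        unfolding R_def by (intro tendsto_intros) auto
      then show "(\<lambda>k. (cmod (R k u))\<^sup>2) \<longlonglongrightarrow> (cmod (R' u))\<^sup>2"
        by (simp add: R'_def mult_ac)
    qed
    show "AE u in \<rho>. norm ((cmod (R k u))\<^sup>2) \<le> 4 * exp (\<bar>u\<bar> * \<kappa>)" for k
    proof (intro AE_I2)
      fix u
      have "cmod (R k u) \<le> 1 + exp (cmod (s * quotient_symbol (dyadic_step k) u))"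
        unfolding R_def by (rule order_trans[OF norm_triangle_ineq4]) (intro add_mono norm_partial_exp_le, simp)
      also have "\<dots> \<le> exp (\<bar>u\<bar> * \<kappa> / 2) + exp (\<bar>u\<bar> * \<kappa> / 2)"
      proof (intro add_mono)
        have "cmod (s * quotient_symbol (dyadic_step k) u) \<le> \<kappa> / 4 * \<bar>u\<bar>"
          unfolding norm_mult using s norm_quotient_symbol_le \<kappa> by (intro mult_mono) auto
        also have "\<dots> \<le> \<bar>u\<bar> * \<kappa> / 2"
          using \<kappa> by (simp add: mult.commute)
        finally show "exp (cmod (s * quotient_symbol (dyadic_step k) u)) \<le> exp (\<bar>u\<bar> * \<kappa> / 2)" by simp
      qed (use \<kappa> in simp)
      finally have "(cmod (R k u))\<^sup>2 \<le> (2 * exp (\<bar>u\<bar> * \<kappa> / 2))\<^sup>2"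
        by (intro power_mono) auto
      also have "\<dots> = 4 * exp (\<bar>u\<bar> * \<kappa>)"
        by (simp add: power_mult_distrib flip: exp_double)
      finally show "norm ((cmod (R k u))\<^sup>2) \<le> 4 * exp (\<bar>u\<bar> * \<kappa>)" by simp
    qed
  qed (use exp_moment in auto)
  have conv: "AE \<omega> in M. \<forall>n. convergent (\<lambda>k. derivative_approx n t k \<omega>)"
    unfolding AE_all_countable using AE_convergent_derivative_approx by blast
  have "(\<integral>\<^sup>+\<omega>. ennreal \<bar>X (t + s) \<omega> - (\<Sum>n\<le>N. taylor_coeff t \<omega> n * s ^ n)\<bar> \<partial>M)
    \<le> ennreal (sqrt (LINT u|\<rho>. (cmod (R' u))\<^sup>2))"
  proof (rule nn_integral_abs_limit_le)
    show "AE \<omega> in M. (\<lambda>k. X (t + s) \<omega> - (\<Sum>n\<le>N. derivative_approx n t k \<omega> / fact n * s ^ n))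
        \<longlonglongrightarrow> X (t + s) \<omega> - (\<Sum>n\<le>N. taylor_coeff t \<omega> n * s ^ n)"
      using conv
    proof eventually_elim
      fix \<omega> assume "\<forall>n. convergent (\<lambda>k. derivative_approx n t k \<omega>)"
      then have "(\<lambda>k. derivative_approx n t k \<omega>) \<longlonglongrightarrow> lim (\<lambda>k. derivative_approx n t k \<omega>)" for n
        using convergent_LIMSEQ_iff by blast
      then show "(\<lambda>k. X (t + s) \<omega> - (\<Sum>n\<le>N. derivative_approx n t k \<omega> / fact n * s ^ n))
        \<longlonglongrightarrow> X (t + s) \<omega> - (\<Sum>n\<le>N. taylor_coeff t \<omega> n * s ^ n)"
        unfolding taylor_coeff_def by (intro tendsto_intros) auto
    qed
    show "(\<integral>\<^sup>+\<omega>. ennreal \<bar>X (t + s) \<omega> - (\<Sum>n\<le>N. derivative_approx n t k \<omega> / fact n * s ^ n)\<bar> \<partial>M)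
        \<le> ennreal (sqrt (LINT u|\<rho>. (cmod (R k u))\<^sup>2))" for k
      using spectral_rep_L1_le[OF spectral_rep_taylor_approx[where t=t and s=s and N=N and k=k]]
      unfolding norm_mult norm_exp_i_times mult_1_right R_def .
    show "(\<lambda>k. sqrt (LINT u|\<rho>. (cmod (R k u))\<^sup>2)) \<longlonglongrightarrow> sqrt (LINT u|\<rho>. (cmod (R' u))\<^sup>2)"
      by (intro tendsto_real_sqrt lim)
  qed measurable
  also have "\<dots> \<le> ennreal (sqrt (LINT u|\<rho>. exp (\<bar>u\<bar> * \<kappa>)) * (1 / 2) ^ N)"
  proof (intro ennreal_leI)
    have R'_le: "cmod (R' u) \<le> (1 / 2) ^ N * exp (\<bar>u\<bar> * \<kappa> / 2)" for u
    proof -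
      have "cmod (R' u) \<le> \<bar>u * s\<bar> ^ Suc N / fact (Suc N)"
        unfolding R'_def by (rule iexp_approx1)
      also have "\<dots> \<le> (\<bar>u\<bar> * \<kappa> / 4) ^ Suc N / fact (Suc N)"
        using mult_left_mono[OF s, of "\<bar>u\<bar>"]
        by (intro divide_right_mono power_mono) (auto simp: abs_mult)
      also have "\<dots> = (1 / 2) ^ Suc N * ((\<bar>u\<bar> * \<kappa> / 2) ^ Suc N / fact (Suc N))"
        by (simp only: times_divide_eq_right power_mult_distrib[symmetric]) simp
      also have "\<dots> \<le> (1 / 2) ^ N * exp (\<bar>u\<bar> * \<kappa> / 2)"
        using power_le_fact_exp[of "\<bar>u\<bar> * \<kappa> / 2" "Suc N"] \<kappa>
        by (intro mult_mono) (auto simp: divide_le_eq mult.commute simp del: fact_Suc)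
      finally show ?thesis .
    qed
    have "(LINT u|\<rho>. (cmod (R' u))\<^sup>2) \<le> (LINT u|\<rho>. ((1 / 2) ^ N)\<^sup>2 * exp (\<bar>u\<bar> * \<kappa>))"
    proof (rule Bochner_Integration.integral_mono')
      fix u
      have "(cmod (R' u))\<^sup>2 \<le> ((1 / 2) ^ N * exp (\<bar>u\<bar> * \<kappa> / 2))\<^sup>2"
        by (intro power_mono R'_le) auto
      also have "\<dots> = ((1 / 2) ^ N)\<^sup>2 * exp (\<bar>u\<bar> * \<kappa>)"
        by (simp add: power_mult_distrib flip: exp_double)
      finally show "(cmod (R' u))\<^sup>2 \<le> ((1 / 2) ^ N)\<^sup>2 * exp (\<bar>u\<bar> * \<kappa>)" .
    qed (use exp_moment in auto)
    then have "sqrt (LINT u|\<rho>. (cmod (R' u))\<^sup>2) \<le> sqrt (((1 / 2) ^ N)\<^sup>2 * (LINT u|\<rho>. exp (\<bar>u\<bar> * \<kappa>)))"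
      by simp
    then show "sqrt (LINT u|\<rho>. (cmod (R' u))\<^sup>2) \<le> sqrt (LINT u|\<rho>. exp (\<bar>u\<bar> * \<kappa>)) * (1 / 2) ^ N"
      by (simp add: real_sqrt_mult mult.commute)
  qed
  finally show ?thesis .
qed

text \<open>
  The \<open>L\<^sup>1\<close> norms of the remainders form a geometric sequence, so almost surely the remainders tend to \<open>0\<close>.
\<close>

lemma AE_taylor_series:
  assumes s: "\<bar>s\<bar> \<le> \<kappa> / 4"
  shows "AE \<omega> in M. (\<lambda>n. taylor_coeff t \<omega> n * s ^ n) sums X (t + s) \<omega>"
proof -
  have "AE \<omega> in M. summable (\<lambda>N. \<bar>X (t + s) \<omega> - (\<Sum>n\<le>N. taylor_coeff t \<omega> n * s ^ n)\<bar>)"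
    using taylor_remainder_L1_le[OF s]
    by (intro AE_summable_of_L1_bounds[where b="\<lambda>N. sqrt (LINT u|\<rho>. exp (\<bar>u\<bar> * \<kappa>)) * (1 / 2) ^ N"])
       (auto intro!: summable_mult Bochner_Integration.integral_nonneg)
  then show ?thesis
  proof eventually_elim
    fix \<omega> assume "summable (\<lambda>N. \<bar>X (t + s) \<omega> - (\<Sum>n\<le>N. taylor_coeff t \<omega> n * s ^ n)\<bar>)"
    then have "(\<lambda>N. X (t + s) \<omega> - (\<Sum>n\<le>N. taylor_coeff t \<omega> n * s ^ n)) \<longlonglongrightarrow> 0"
      using summable_LIMSEQ_zero tendsto_rabs_zero_iff by blast
    then have "(\<lambda>N. X (t + s) \<omega> - (X (t + s) \<omega> - (\<Sum>n\<le>N. taylor_coeff t \<omega> n * s ^ n))) \<longlonglongrightarrow> X (t + s) \<omega> - 0"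
      by (intro tendsto_intros)
    then show "(\<lambda>n. taylor_coeff t \<omega> n * s ^ n) sums X (t + s) \<omega>"
      by (simp add: sums_def_le)
  qed
qed

end
end

section \<open>Smoothness of paths with local power series\<close>

text \<open>
  Real analyticity, with the centre \<open>t\<close> only near \<open>x\<close>: this suits expansions at rational centres, and it
  passes to the derivative with the same centres and radii.
\<close>

definition locally_power_series :: "(real \<Rightarrow> real) \<Rightarrow> bool" where
  "locally_power_series f \<longleftrightarrow>
     (\<forall>x. \<exists>t r c. \<bar>x - t\<bar> < r \<and> (\<forall>s. \<bar>s\<bar> < r \<longrightarrow> (\<lambda>n. c n * s ^ n) sums f (t + s)))"

lemma locally_power_series_deriv:
  assumes "locally_power_series f"
  shows "f differentiable (at x)" "locally_power_series (deriv f)"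
proof -
  have *: "(f has_real_derivative (\<Sum>n. diffs c n * s ^ n)) (at (t + s))" "(\<lambda>n. diffs c n * s ^ n) sums deriv f (t + s)"
    if f: "\<And>s. \<bar>s\<bar> < r \<Longrightarrow> (\<lambda>n. c n * s ^ n) sums f (t + s)" and s: "\<bar>s\<bar> < r" for r t c s
  proof -
    have summable: "\<And>z. norm z < r \<Longrightarrow> summable (\<lambda>n. c n * z ^ n)"
      using f by (auto intro: sums_summable)
    have "((\<lambda>z. \<Sum>n. c n * z ^ n) has_real_derivative (\<Sum>n. diffs c n * s ^ n)) (at s)"
      by (rule termdiffs_strong'[OF summable]) (use s in auto)
    then have "((\<lambda>z. f (t + z)) has_real_derivative (\<Sum>n. diffs c n * s ^ n)) (at s)"
      by (rule has_field_derivative_transform_within_open[where S="{-r<..<r}"])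
         (use s f in \<open>auto simp: sums_iff abs_less_iff\<close>)
    then show D: "(f has_real_derivative (\<Sum>n. diffs c n * s ^ n)) (at (t + s))"
      by (simp add: DERIV_shift add.commute)
    have "summable (\<lambda>n. diffs c n * s ^ n)"
      by (rule termdiff_converges[where K=r]) (use s summable in auto)
    then show "(\<lambda>n. diffs c n * s ^ n) sums deriv f (t + s)"
      using DERIV_imp_deriv[OF D] by (simp add: summable_sums)
  qed
  show "f differentiable (at x)"
  proof -
    obtain t r c where "\<bar>x - t\<bar> < r" "\<And>s. \<bar>s\<bar> < r \<Longrightarrow> (\<lambda>n. c n * s ^ n) sums f (t + s)"
      using assms unfolding locally_power_series_def by metis
    from *(1)[OF this(2,1)] show ?thesis
      by (auto simp: real_differentiable_def)
  qed
  show "locally_power_series (deriv f)"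
    unfolding locally_power_series_def
  proof
    fix x
    obtain t r c where "\<bar>x - t\<bar> < r" "\<And>s. \<bar>s\<bar> < r \<Longrightarrow> (\<lambda>n. c n * s ^ n) sums f (t + s)"
      using assms unfolding locally_power_series_def by metis
    with *(2)[of r c t] show "\<exists>t r c. \<bar>x - t\<bar> < r \<and> (\<forall>s. \<bar>s\<bar> < r \<longrightarrow> (\<lambda>n. c n * s ^ n) sums deriv f (t + s))"
      by blast
  qed
qed

lemma C_infinity_of_locally_power_series:
  assumes "locally_power_series f"
  shows "C_infinity f"
proof -
  have "locally_power_series ((deriv ^^ n) f)" for n
    by (induction n) (simp_all add: assms locally_power_series_deriv(2))
  then show ?thesis
    unfolding C_infinity_def differentiable_on_def
    using locally_power_series_deriv(1) by blast
qed

lemma continuous_of_abs_continuous_path: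
  assumes "abs_continuous_path f"
  shows "isCont f x"
  unfolding continuous_at_eps_delta
proof (intro allI impI)
  fix \<epsilon> :: real assume "0 < \<epsilon>"
  have "abs_continuous_on_interval (x - 1) (x + 1) f"
    using assms by (simp add: abs_continuous_path_def)
  then obtain \<delta> where \<delta>: "0 < \<delta>" and
    ac: "\<And>(n::nat) u v. (\<forall>i<n. x - 1 \<le> u i \<and> u i \<le> v i \<and> v i \<le> x + 1) \<Longrightarrow>
        disjoint_family_on (\<lambda>i. {u i<..<v i}) {..<n} \<Longrightarrow> (\<Sum>i<n. v i - u i) < \<delta> \<Longrightarrow>
        (\<Sum>i<n. \<bar>f (v i) - f (u i)\<bar>) < \<epsilon>"
    unfolding abs_continuous_on_interval_def using \<open>0 < \<epsilon>\<close> by meson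
  have "\<bar>f y - f x\<bar> < \<epsilon>" if "\<bar>y - x\<bar> < min \<delta> 1" for y
    using ac[of 1 "\<lambda>_. min x y" "\<lambda>_. max x y"] that
    by (auto simp: disjoint_family_on_def min_def max_def abs_if split: if_splits)
  then show "\<exists>d>0. \<forall>y. dist y x < d \<longrightarrow> dist (f y) (f x) < \<epsilon>"
    using \<delta> by (intro exI[of _ "min \<delta> 1"]) (auto simp: dist_real_def)
qed

lemma eq_of_eq_on_Rats:
  fixes f g :: "real \<Rightarrow> real"
  assumes "isCont f x" "isCont g x" "0 < r" and eq: "\<And>y. y \<in> \<rat> \<Longrightarrow> \<bar>y - x\<bar> < r \<Longrightarrow> f y = g y"
  shows "f x = g x"
proof (rule ccontr)
  assume "f x \<noteq> g x"
  have "isCont (\<lambda>y. f y - g y) x"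
    using assms by (intro continuous_intros)
  from continuous_at_avoid[OF this, of 0] \<open>f x \<noteq> g x\<close>
  obtain e where e: "0 < e" "\<And>y. dist x y < e \<Longrightarrow> f y - g y \<noteq> 0"
    by auto
  obtain y where "y \<in> \<rat>" "x < y" "y < x + min e r"
    using Rats_dense_in_real[of x "x + min e r"] e \<open>0 < r\<close> by auto
  then show False
    using e(2)[of y] eq[of y] by (auto simp: dist_real_def min_def split: if_splits)
qed

text \<open>
  The expansion holds almost surely only for countably many pairs of a centre and an increment. Convergence at
  one rational \<open>s0\<close> gives a continuous sum on \<open>{-s0<..<s0}\<close>, which agrees with the continuous function \<open>f\<close> on
  the rationals and hence on the interval; every real number lies within \<open>s0\<close> of a rational centre.
\<close>

lemma C_infinity_of_rational_power_series:
  assumes cont: "\<And>x. isCont f x" and "0 < R"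
    and sums: "\<And>t s. t \<in> \<rat> \<Longrightarrow> s \<in> \<rat> \<Longrightarrow> \<bar>s\<bar> \<le> R \<Longrightarrow> (\<lambda>n. c t n * s ^ n) sums f (t + s)"
  shows "C_infinity f"
proof (rule C_infinity_of_locally_power_series, unfold locally_power_series_def, rule allI)
  fix x
  obtain s0 where s0: "s0 \<in> \<rat>" "0 < s0" "s0 < R"
    using Rats_dense_in_real[OF \<open>0 < R\<close>] by blast
  obtain t where t: "t \<in> \<rat>" "x < t" "t < x + s0"
    using Rats_dense_in_real[of x "x + s0"] s0 by auto
  have summable: "summable (\<lambda>n. c t n * s0 ^ n)"
    using sums[OF t(1) s0(1)] s0 by (auto intro: sums_summable)
  have "(\<lambda>n. c t n * s ^ n) sums f (t + s)" if s: "\<bar>s\<bar> < s0" for s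
  proof -
    have "f (t + s) = (\<Sum>n. c t n * s ^ n)"
    proof (rule eq_of_eq_on_Rats[where f="\<lambda>s. f (t + s)" and x=s and r="s0 - \<bar>s\<bar>"])
      show "isCont (\<lambda>s. f (t + s)) s"
        by (intro isCont_o2[OF _ cont] continuous_intros)
      show "isCont (\<lambda>s. \<Sum>n. c t n * s ^ n) s"
        by (rule isCont_powser[OF summable]) (use s in auto)
      show "0 < s0 - \<bar>s\<bar>" using s by simp
      fix y assume "y \<in> \<rat>" "\<bar>y - s\<bar> < s0 - \<bar>s\<bar>"
      then show "f (t + y) = (\<Sum>n. c t n * y ^ n)"
        using sums[OF t(1), of y] s0 by (auto simp: sums_iff)
    qed
    moreover have "summable (\<lambda>n. c t n * s ^ n)"
      by (rule powser_inside[OF summable]) (use s in auto)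
    ultimately show ?thesis by (simp add: summable_sums)
  qed
  then show "\<exists>t r c. \<bar>x - t\<bar> < r \<and> (\<forall>s. \<bar>s\<bar> < r \<longrightarrow> (\<lambda>n. c n * s ^ n) sums f (t + s))"
    using t by (intro exI[of _ t] exI[of _ s0] exI[of _ "c t"]) auto
qed

lemma (in spectral_process) AE_C_infinity:
  assumes \<kappa>: "0 < \<kappa>" "integrable \<rho> (\<lambda>u. exp (\<bar>u\<bar> * \<kappa>))"
    and cont: "AE \<omega> in M. \<forall>x. isCont (\<lambda>t. X t \<omega>) x"
  shows "AE \<omega> in M. C_infinity (\<lambda>t. X t \<omega>)"
proof -
  have "AE \<omega> in M. \<forall>t\<in>\<rat>. \<forall>s\<in>\<rat> \<inter> {s. \<bar>s\<bar> \<le> \<kappa> / 4}. (\<lambda>n. taylor_coeff t \<omega> n * s ^ n) sums X (t + s) \<omega>"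
    using countable_rat by (intro AE_ball_countable' AE_taylor_series[OF \<kappa>]) auto
  with cont show ?thesis
  proof eventually_elim
    fix \<omega> assume "\<forall>x. isCont (\<lambda>t. X t \<omega>) x"
      and "\<forall>t\<in>\<rat>. \<forall>s\<in>\<rat> \<inter> {s. \<bar>s\<bar> \<le> \<kappa> / 4}. (\<lambda>n. taylor_coeff t \<omega> n * s ^ n) sums X (t + s) \<omega>"
    then show "C_infinity (\<lambda>t. X t \<omega>)"
      using \<kappa>(1) by (intro C_infinity_of_rational_power_series[where R="\<kappa> / 4" and c="\<lambda>t. taylor_coeff t \<omega>"]) auto
  qed
qed

theorem proposition1p7:
  fixes M :: "'a measure"
    and X :: "real \<Rightarrow> 'a \<Rightarrow> real"
    and r :: "real \<Rightarrow> real"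
    and \<rho> :: "real measure"
  assumes gaussian: "gaussian_process M X"
    and stationary: "stationary_process M X"
    and centered: "\<And>t. prob_space.expectation M (X t) = 0"
    and unit_variance: "\<And>t. prob_space.variance M (X t) = 1"
    and abs_cont: "AE \<omega> in M. abs_continuous_path (\<lambda>t. X t \<omega>)"
    and cov: "\<And>t s. covariance M (X t) (X s) = r (t - s)"
    and spectral: "spectral_measure r \<rho>"
    and second_moment: "integrable \<rho> (\<lambda>u. u\<^sup>2)"
    and a_or_b:
      "(compact (measure_support \<rho>) \<and> integrable lborel (\<lambda>t. \<bar>r t\<bar>)) \<or>
       (\<exists>\<kappa>>0. integrable \<rho> (\<lambda>u. exp (\<bar>u\<bar> * \<kappa>)) \<and>
          (\<exists>\<kappa>\<^sub>o. 0 < \<kappa>\<^sub>o \<and> \<kappa>\<^sub>o < \<kappa> / 2 \<and>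
             integrable lborel (\<lambda>t. \<bar>r_cosh \<rho> \<kappa>\<^sub>o t\<bar>)))"
  shows "assumption_A \<rho> \<and> has_bounded_continuous_density \<rho> \<and>
         (AE \<omega> in M. C_infinity (\<lambda>t. X t \<omega>))"
proof -
  have dist: "real_distribution \<rho>" and ft: "complex_of_real (r t) = fourier_transform \<rho> t" for t
    using spectral by (auto simp: spectral_measure_def)
  obtain \<kappa> where \<kappa>: "0 < \<kappa>" "integrable \<rho> (\<lambda>u. exp (\<bar>u\<bar> * \<kappa>))"
    using a_or_b exp_moment_of_compact_support[OF dist, of 1] zero_less_one by blast
  have X: "X t \<in> borel_measurable M" for t
    using gaussian by (simp add: gaussian_process_def)
  have cov_eq: "(\<integral>\<omega>. X t \<omega> * X s \<omega> \<partial>M) = r (t - s)" for t s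
    using cov[of t s] centered by (simp add: covariance_def)
  have "spectral_process M X \<rho>"
  proof (intro spectral_process.intro spectral_process_axioms.intro)
    \<comment> \<open>A square that is not integrable would have Bochner integral \<open>0\<close>, not \<open>1\<close>.\<close>
    show "integrable M (\<lambda>\<omega>. (X t \<omega>)\<^sup>2)" for t
      using unit_variance[of t] centered[of t] not_integrable_integral_eq by fastforce
    show "complex_of_real (\<integral>\<omega>. X t \<omega> * X s \<omega> \<partial>M) = (CLINT u|\<rho>. iexp (u * (t - s)))" for t s
    proof -
      \<comment> \<open>The kernel of \<open>fourier_transform\<close> is \<open>exp (- \<i> * u * t)\<close>, so \<open>iexp (u * (t - s))\<close> comes from \<open>r (s - t)\<close>.\<close>
      have "(\<integral>\<omega>. X t \<omega> * X s \<omega> \<partial>M) = r (s - t)"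
        using cov_eq[of s t] by (simp add: mult.commute)
      then show ?thesis
        by (simp add: ft fourier_transform_def algebra_simps)
    qed
  qed (use gaussian X dist in \<open>auto simp: gaussian_process_def\<close>)
  then have "AE \<omega> in M. C_infinity (\<lambda>t. X t \<omega>)"
    using \<kappa> by (rule spectral_process.AE_C_infinity)
      (use abs_cont in \<open>auto elim!: eventually_mono intro: continuous_of_abs_continuous_path\<close>)
  moreover have "assumption_A \<rho> \<and> has_bounded_continuous_density \<rho>"
    using a_or_b compact_support_case[OF spectral] exp_moment_case[OF spectral] by blast
  ultimately show ?thesis by blast
qed

end
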